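(* Let $X_1, X_2, \ldots$ be independent real random variables with partial sums $S_n = X_1+\cdots+X_n$. Let $(d_k)_{k\ge 1}$ be a sequence of positive constants and $D_N=\sum_{k=1}^N d_k$. Let $(a_n)_{n\ge1}$, $(b_n)_{n\ge 1}$ be real sequences with $a_n>0$. Assume that: (C1) $\frac{S_n}{a_n}-b_n$ converges in distribution to $H$, where $H$ is some (possibly degenerate) distribution function; (C2) $\liminf_{k\to\infty} k d_k>0$, and for some $0<\alpha<1$ the sequence $d_k k^\alpha$ is eventually non-increasing; (C3) for some $\rho>0$, $d_k=O\Big(\frac{D_k}{k(\log D_k)^\rho}\Big)$ as $k\to\infty$; (C4) there exist positive constants $C,\beta$ such that $a_k/a_l\le C(k/l)^\beta$ for all $1\le k\le l$; furthermore, for some $0<r<\rho$ (with $\rho$ as in (C3)) and some integer $\mu\ge \max\{2,\,4/(\rho-r)\}$, $$\mathbb{E}\Big|\frac{S_n}{a_n}-b_n\Big|^\mu=O(1).$$ Then for every Lipschitz function $f:\mathbb{R}\to\mathbb{R}$, $$\lim_{N\to\infty}D_N^{-1}\sum_{k=1}^N d_k f\Big(\frac{S_k}{a_k}-b_k\Big)=\int_{-\infty}^{\infty}f(x)\,dH(x)\quad\text{almost surely}.$$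
   Context: All random variables are defined on a common probability space. $O(\cdot)$ is understood as the index tends to infinity. *)

theory Defs
  imports "HOL-Probability.Probability" "HOL-Library.Landau_Symbols"
begin

text \<open>All sequences are indexed by the positive integers; values at index \<open>0\<close> are never
  constrained and play no role.\<close>

definition partial_sum :: "(nat \<Rightarrow> 'a \<Rightarrow> real) \<Rightarrow> nat \<Rightarrow> 'a \<Rightarrow> real" where
  "partial_sum X n \<omega> = (\<Sum>i=1..n. X i \<omega>)"

definition normalized_sum ::
    "(nat \<Rightarrow> 'a \<Rightarrow> real) \<Rightarrow> (nat \<Rightarrow> real) \<Rightarrow> (nat \<Rightarrow> real) \<Rightarrow> nat \<Rightarrow> 'a \<Rightarrow> real" where
  "normalized_sum X a b n \<omega> = partial_sum X n \<omega> / a n - b n"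

definition weight_sum :: "(nat \<Rightarrow> real) \<Rightarrow> nat \<Rightarrow> real" where
  "weight_sum d N = (\<Sum>k=1..N. d k)"

text \<open>Right-continuous convention, as required by \<open>interval_measure\<close>, which turns such
  a function into its Lebesgue--Stieltjes measure. Point masses are included.\<close>

definition distribution_function :: "(real \<Rightarrow> real) \<Rightarrow> bool" where
  "distribution_function H \<longleftrightarrow>
     mono H \<and> (\<forall>x. continuous (at_right x) H) \<and>
     (H \<longlongrightarrow> 0) at_bot \<and> (H \<longlongrightarrow> 1) at_top"

end

theory Submission
  imports Defs
begin

text \<open>Write \<open>Y\<^sub>k = S\<^sub>k / a\<^sub>k - b\<^sub>k\<close> and \<open>D\<^sub>N = d\<^sub>1 + \<dots> + d\<^sub>N\<close>. For a Lipschitz function \<open>f\<close> the proof separates the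
mean of the weighted average \<open>D\<^sub>N\<inverse> \<Sum> d\<^sub>k f(Y\<^sub>k)\<close> from its fluctuation.

The mean converges because \<open>E f(Y\<^sub>k)\<close> does: the convergence in distribution together with bounded
second moments allows \<open>f\<close> to be replaced by bounded truncations
(\<open>weak_conv_bounded_second_moment\<close>), and weighted means preserve limits since \<open>D\<^sub>N\<close> tends to infinity
(\<open>weighted_mean_tendsto\<close>).

The fluctuation is controlled by a moment of even order \<open>2 m\<close>, where \<open>m = \<mu> div 2\<close>. The sum
\<open>T\<^sub>N = \<Sum>\<^sub>k\<^sub>\<le>\<^sub>N d\<^sub>k f(Y\<^sub>k)\<close> is a function of the independent variables \<open>X\<^sub>1, \<dots>, X\<^sub>N\<close> that is Lipschitz in
\<open>X\<^sub>j\<close> with constant \<open>w\<^sub>j = L (d\<^sub>j / a\<^sub>j + \<dots> + d\<^sub>N / a\<^sub>N)\<close>. Its martingale differences are therefore dominated by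
independent variables, and a Burkholder type argument bounds the moments of \<open>(T\<^sub>N - E T\<^sub>N)\<^sup>2\<close> by those of
\<open>\<Sum>\<^sub>j w\<^sub>j\<^sup>2 (X\<^sub>j - E X\<^sub>j)\<^sup>2\<close> (\<open>lipschitz_functional_moments_le\<close>). Expanding \<open>w\<^sub>j\<^sup>2\<close> turns this into a
combination of the partial sums \<open>Q\<^sub>k = \<Sum>\<^sub>j\<^sub>\<le>\<^sub>k (X\<^sub>j - E X\<^sub>j)\<^sup>2\<close>, and a reverse inequality
(\<open>sum_squares_moments_le_square_sum\<close>) bounds the moment of order \<open>m\<close> of \<open>Q\<^sub>k\<close> by that of
\<open>(S\<^sub>k - E S\<^sub>k)\<^sup>2\<close>, which is \<open>O(a\<^sub>k\<^bsup>2 m\<^esup>)\<close> by hypothesis. The outcome is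
\<open>E (T\<^sub>N - E T\<^sub>N)\<^bsup>2 m\<^esup> = O((\<Sum>\<^sub>k\<^sub>\<le>\<^sub>l\<^sub>\<le>\<^sub>N d\<^sub>k d\<^sub>l a\<^sub>k / a\<^sub>l)\<^sup>m)\<close>
(\<open>weighted_lipschitz_sum_moment\<close>).

Both comparisons rest on one elementary fact: up to the linear term \<open>2 k x\<^bsup>2 k - 1\<^esup> y\<close>, which has mean
zero when \<open>y\<close> is a martingale difference, \<open>(x + y)\<^bsup>2 k\<^esup>\<close> lies between two expressions of the form
\<open>(x\<^sup>2 + c y\<^sup>2)\<^sup>k\<close>.

Since \<open>a\<^sub>k / a\<^sub>l = O((k / l)\<^sup>\<beta>)\<close> and \<open>d\<^sub>k = O(D\<^sub>k / (k (log D\<^sub>k)\<^sup>\<rho>))\<close>, the double sum is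
\<open>O(D\<^sub>N\<^sup>2 / (log D\<^sub>N)\<^sup>\<rho>)\<close> (\<open>weighted_correlation_sum_le\<close>), so that the moment of order \<open>2 m\<close> of
\<open>(T\<^sub>N - E T\<^sub>N) / D\<^sub>N\<close> is \<open>O((log D\<^sub>N)\<^bsup>- m \<rho>\<^esup>)\<close>. The hypothesis on \<open>\<mu>\<close> gives \<open>m \<rho> > 1\<close>. Hence these moments
are summable along indices at which \<open>D\<^sub>N\<close> is about \<open>exp(j\<^sup>\<theta>)\<close>, for some \<open>\<theta> < 1\<close> with \<open>\<theta> m \<rho> > 1\<close>, and
the fluctuation vanishes almost surely along them. Because \<open>\<theta> < 1\<close>, consecutive levels have ratio
tending to one; for nonnegative \<open>f\<close> monotonicity of \<open>T\<^sub>N\<close> fills the gaps (\<open>convergence_along_levels\<close>), and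
a general \<open>f\<close> is the difference of its positive and negative parts.\<close>

section \<open>Polynomial inequalities for even powers\<close>

lemma power_sum_le_two_power:
  fixes a b :: real
  assumes "0 \<le> a" "0 \<le> b"
  shows "(a + b) ^ n \<le> 2 ^ n * (a ^ n + b ^ n)"
proof -
  have "(a + b) ^ n \<le> (2 * max a b) ^ n"
    using assms by (intro power_mono) auto
  also have "\<dots> = 2 ^ n * max a b ^ n" by (simp add: power_mult_distrib)
  also have "\<dots> \<le> 2 ^ n * (a ^ n + b ^ n)"
    using assms by (intro mult_left_mono) (auto simp: max_def)
  finally show ?thesis .
qed

lemma power_le_one_plus_power:
  fixes x :: real
  assumes "0 \<le> x" "i \<le> p"
  shows "x ^ i \<le> 1 + x ^ p"
proof (cases "x \<le> 1")
  case True
  then show ?thesis using assms by (smt (verit) power_le_one zero_le_power)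
next
  case False
  then have "x ^ i \<le> x ^ p" using assms by (intro power_increasing) auto
  then show ?thesis by simp
qed

text \<open>Controls the remainder of the first-order Taylor polynomial of the power, in a form whose factor
\<open>(x\<^sup>2 + y\<^sup>2)\<^sup>k\<close> can be absorbed into a power of \<open>x\<^sup>2 + \<kappa> y\<^sup>2\<close>.\<close>

lemma even_power_add_le_Taylor:
  "\<exists>c\<ge>0. \<forall>x y :: real. (x + y) ^ (2 * Suc k) \<le>
     x ^ (2 * Suc k) + 2 * real (Suc k) * x ^ (2 * k + 1) * y + c * y\<^sup>2 * (x\<^sup>2 + y\<^sup>2) ^ k"
proof (induction k)
  case 0
  show ?case by (intro exI[of _ 1]) (auto simp: power2_eq_square algebra_simps)
next
  case (Suc k)
  then obtain c where c: "c \<ge> 0" "\<And>x y :: real. (x + y) ^ (2 * Suc k) \<le>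
     x ^ (2 * Suc k) + 2 * real (Suc k) * x ^ (2 * k + 1) * y + c * y\<^sup>2 * (x\<^sup>2 + y\<^sup>2) ^ k" by blast
  define K where "K = real (Suc k)"
  have K: "K \<ge> 1" by (simp add: K_def)
  show ?case
  proof (intro exI[of _ "2 * c + 6 * K + 1"] conjI allI)
    show "0 \<le> 2 * c + 6 * K + 1" using c K by simp
    fix x y :: real
    let ?s = "x\<^sup>2 + y\<^sup>2"
    let ?p = "x ^ (2 * k)"
    have p0: "?p \<ge> 0" by simp
    have pp: "?p \<le> ?s ^ k" unfolding power_mult by (intro power_mono) auto
    have xy: "\<bar>x * y\<bar> \<le> ?s" using sum_squares_bound[of "\<bar>x\<bar>" "\<bar>y\<bar>"] mult_nonneg_nonneg[of "\<bar>x\<bar>" "\<bar>y\<bar>"]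
      unfolding abs_mult power2_abs by linarith
    have sq: "(x + y)\<^sup>2 \<le> 2 * ?s" using sum_squares_bound[of x y]
      by (simp add: power2_eq_square algebra_simps)
    have a1: "y\<^sup>2 * (x\<^sup>2 * ?p) \<le> y\<^sup>2 * (?s * ?s ^ k)"
      using pp p0 by (intro mult_left_mono mult_mono) auto
    have a2: "y\<^sup>2 * ((x * y) * ?p) \<le> y\<^sup>2 * (?s * ?s ^ k)"
      using pp p0 xy by (intro mult_left_mono mult_mono) auto
    have a3: "(x + y)\<^sup>2 * (c * y\<^sup>2 * ?s ^ k) \<le> 2 * ?s * (c * y\<^sup>2 * ?s ^ k)"
      using c by (intro mult_right_mono[OF sq]) auto
    have "(x + y) ^ (2 * Suc (Suc k)) = (x + y)\<^sup>2 * (x + y) ^ (2 * Suc k)"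
      by (simp add: power2_eq_square)
    also have "\<dots> \<le> (x + y)\<^sup>2 * (x ^ (2 * Suc k) + 2 * real (Suc k) * x ^ (2 * k + 1) * y + c * y\<^sup>2 * ?s ^ k)"
      by (rule mult_left_mono[OF c(2)]) simp
    also have "\<dots> = (x + y)\<^sup>2 * (x\<^sup>2 * ?p + 2 * K * (x * ?p) * y) + (x + y)\<^sup>2 * (c * y\<^sup>2 * ?s ^ k)"
      unfolding K_def by (simp add: power2_eq_square algebra_simps)
    also have "\<dots> \<le> (x + y)\<^sup>2 * (x\<^sup>2 * ?p + 2 * K * (x * ?p) * y) + 2 * ?s * (c * y\<^sup>2 * ?s ^ k)"
      using a3 by simp
    also have "(x + y)\<^sup>2 * (x\<^sup>2 * ?p + 2 * K * (x * ?p) * y) =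
       x^4 * ?p + 2 * (K + 1) * (x ^ 3 * ?p) * y + (1 + 4 * K) * (y\<^sup>2 * (x\<^sup>2 * ?p)) + 2 * K * (y\<^sup>2 * ((x * y) * ?p))"
      by algebra
    also have "\<dots> \<le> x^4 * ?p + 2 * (K + 1) * (x ^ 3 * ?p) * y + (1 + 4 * K) * (y\<^sup>2 * (?s * ?s ^ k)) + 2 * K * (y\<^sup>2 * (?s * ?s ^ k))"
      using K by (intro add_mono mult_left_mono order_refl a1 a2) auto
    also have "x^4 * ?p + 2 * (K + 1) * (x ^ 3 * ?p) * y + (1 + 4 * K) * (y\<^sup>2 * (?s * ?s ^ k)) + 2 * K * (y\<^sup>2 * (?s * ?s ^ k)) + 2 * ?s * (c * y\<^sup>2 * ?s ^ k)
      = x^4 * ?p + 2 * (K + 1) * (x ^ 3 * ?p) * y + (2 * c + 6 * K + 1) * y\<^sup>2 * ?s ^ Suc k"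
      by (simp add: algebra_simps)
    also have "x^4 * ?p = x ^ (2 * Suc (Suc k))" by (simp add: power_add[symmetric] eval_nat_numeral)
    also have "x^3 * ?p = x ^ (2 * Suc k + 1)" by (simp add: power_add[symmetric] eval_nat_numeral)
    finally show "(x + y) ^ (2 * Suc (Suc k)) \<le> x ^ (2 * Suc (Suc k)) + 2 * real (Suc (Suc k)) * x ^ (2 * Suc k + 1) * y + (2 * c + 6 * K + 1) * y\<^sup>2 * ?s ^ Suc k"
      by (simp add: K_def algebra_simps)
  qed
qed

text \<open>This is what bounds martingales: if \<open>y\<close> has conditional mean zero given \<open>x\<close>, the term linear in \<open>y\<close>
disappears in expectation. The constant serves all exponents up to \<open>m\<close> simultaneously because the
comparison of moments below proceeds through all lower orders.\<close>

lemma even_power_add_upper: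
  "\<exists>\<kappa>\<ge>0. \<forall>k\<le>m. \<forall>x y :: real. (x + y) ^ (2 * k) \<le>
     2 * real k * x ^ (2 * k - 1) * y + (x\<^sup>2 + \<kappa> * y\<^sup>2) ^ k"
proof (induction m)
  case 0
  show ?case by (intro exI[of _ 0]) auto
next
  case (Suc m)
  then obtain \<kappa> where \<kappa>: "\<kappa> \<ge> 0" "\<And>k (x :: real) y. k \<le> m \<Longrightarrow> (x + y) ^ (2 * k) \<le>
     2 * real k * x ^ (2 * k - 1) * y + (x\<^sup>2 + \<kappa> * y\<^sup>2) ^ k"
    by blast
  obtain c where c: "c \<ge> 0" "\<And>x y :: real. (x + y) ^ (2 * Suc m) \<le>
     x ^ (2 * Suc m) + 2 * real (Suc m) * x ^ (2 * m + 1) * y + c * y\<^sup>2 * (x\<^sup>2 + y\<^sup>2) ^ m"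
    using even_power_add_le_Taylor[of m] by blast
  define \<kappa>' where "\<kappa>' = \<kappa> + c + 1"
  show ?case
  proof (intro exI[of _ \<kappa>'] conjI allI impI)
    show "0 \<le> \<kappa>'" using \<kappa> c by (simp add: \<kappa>'_def)
    fix k and x y :: real assume k: "k \<le> Suc m"
    show "(x + y) ^ (2 * k) \<le> 2 * real k * x ^ (2 * k - 1) * y + (x\<^sup>2 + \<kappa>' * y\<^sup>2) ^ k"
    proof (cases "k \<le> m")
      case True
      have "(x\<^sup>2 + \<kappa> * y\<^sup>2) ^ k \<le> (x\<^sup>2 + \<kappa>' * y\<^sup>2) ^ k"
        using \<kappa> c by (intro power_mono add_left_mono mult_right_mono) (auto simp: \<kappa>'_def)
      with \<kappa>(2)[OF True, of x y] show ?thesis by simp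
    next
      case False
      with k have k: "k = Suc m" by simp
      define z where "z = x\<^sup>2 + \<kappa>' * y\<^sup>2"
      have z: "x\<^sup>2 + y\<^sup>2 \<le> z" "x\<^sup>2 \<le> z"
        using \<kappa> c by (auto simp: z_def \<kappa>'_def algebra_simps)
      have "c * y\<^sup>2 * (x\<^sup>2 + y\<^sup>2) ^ m \<le> (\<kappa>' * y\<^sup>2) * z ^ m"
        using \<kappa> c z by (intro mult_mono power_mono mult_right_mono) (auto simp: \<kappa>'_def)
      moreover have "x ^ (2 * Suc m) \<le> x\<^sup>2 * z ^ m"
        unfolding power_mult power_Suc by (intro mult_left_mono power_mono z) auto
      ultimately have "x ^ (2 * Suc m) + c * y\<^sup>2 * (x\<^sup>2 + y\<^sup>2) ^ m \<le> z ^ Suc m"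
        by (simp add: z_def algebra_simps)
      with c(2)[of x y] show ?thesis unfolding k z_def by simp
    qed
  qed
qed

text \<open>Bernoulli's inequality in homogeneous form: a power lies above its tangent.\<close>

lemma power_tangent_le:
  fixes a b :: real
  assumes "0 \<le> a" "0 \<le> a + b"
  shows "a ^ Suc n + real (Suc n) * a ^ n * b \<le> (a + b) ^ Suc n"
proof (induction n)
  case (Suc n)
  have "a ^ Suc (Suc n) + Suc (Suc n) * a ^ Suc n * b \<le> a ^ Suc (Suc n) + Suc (Suc n) * a ^ Suc n * b + real (Suc n) * a ^ n * b\<^sup>2"
    using assms by simp
  also have "\<dots> = (a + b) * (a ^ Suc n + real (Suc n) * a ^ n * b)"
    by (simp add: power2_eq_square algebra_simps)
  also have "\<dots> \<le> (a + b) * (a + b) ^ Suc n"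
    by (intro mult_left_mono Suc assms)
  finally show ?case by simp
qed auto

lemma sum_power_le_power_sum:
  fixes a b :: real
  assumes "0 \<le> a" "0 \<le> b"
  shows "a ^ Suc n + b ^ Suc n \<le> (a + b) ^ Suc n"
proof (induction n)
  case (Suc n)
  have "a ^ Suc (Suc n) + b ^ Suc (Suc n) \<le> (a + b) * (a ^ Suc n + b ^ Suc n)"
    using assms by (simp add: algebra_simps)
  also have "\<dots> \<le> (a + b) * (a + b) ^ Suc n"
    using assms by (intro mult_left_mono Suc) auto
  finally show ?case by simp
qed auto

text \<open>Two lower bounds for the Taylor remainder, efficient for small and for large \<open>y\<close> respectively. The first
is the tangent at \<open>x\<^sup>2\<close> evaluated at \<open>(x + y)\<^sup>2\<close>. The second is an inequality of Clarkson type for the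
midpoint \<open>x + y / 2\<close>.\<close>

lemma even_power_add_ge_parts:
  fixes x y :: real
  shows "x ^ (2 * Suc n) + 2 * real (Suc n) * x ^ (2 * n + 1) * y + real (Suc n) * x ^ (2 * n) * y\<^sup>2
            \<le> (x + y) ^ (2 * Suc n)" (is ?A)
    and "x ^ (2 * Suc n) + 2 * real (Suc n) * x ^ (2 * n + 1) * y + 2 * (y / 2) ^ (2 * Suc n)
            \<le> (x + y) ^ (2 * Suc n)" (is ?B)
proof -
  show ?A
    using power_tangent_le[of "x\<^sup>2" "2 * x * y + y\<^sup>2" n] zero_le_power2[of "x + y"]
    unfolding power_mult power_add power2_sum
    by (simp add: power2_eq_square algebra_simps)
  define p q where "p = x + y / 2" and "q = y / 2"
  have xpq: "x = p - q" "x + y = p + q" by (auto simp: p_def q_def)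
  \<comment> \<open>convexity of the power, applied to the squares of \<open>p + q\<close> and \<open>p - q\<close>\<close>
  have "(p\<^sup>2 + q\<^sup>2) ^ Suc n + real (Suc n) * (p\<^sup>2 + q\<^sup>2) ^ n * (2 * p * q) \<le> (p\<^sup>2 + q\<^sup>2 + 2 * p * q) ^ Suc n"
    by (rule power_tangent_le) (use zero_le_power2[of "p + q"] in \<open>auto simp: power2_sum\<close>)
  also have "p\<^sup>2 + q\<^sup>2 + 2 * p * q = (p + q)\<^sup>2" by (simp add: power2_sum)
  finally have 1: "(p\<^sup>2 + q\<^sup>2) ^ Suc n + real (Suc n) * (p\<^sup>2 + q\<^sup>2) ^ n * (2 * p * q) \<le> (p + q) ^ (2 * Suc n)"
    by (simp only: power_mult)
  have "(p\<^sup>2 + q\<^sup>2) ^ Suc n + real (Suc n) * (p\<^sup>2 + q\<^sup>2) ^ n * (- (2 * p * q)) \<le> (p\<^sup>2 + q\<^sup>2 + - (2 * p * q)) ^ Suc n"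
    by (rule power_tangent_le) (use zero_le_power2[of "p - q"] in \<open>auto simp: power2_diff\<close>)
  also have "p\<^sup>2 + q\<^sup>2 + - (2 * p * q) = (p - q)\<^sup>2" by (simp add: power2_diff)
  finally have 2: "(p\<^sup>2 + q\<^sup>2) ^ Suc n - real (Suc n) * (p\<^sup>2 + q\<^sup>2) ^ n * (2 * p * q) \<le> (p - q) ^ (2 * Suc n)"
    by (simp only: power_mult)
  have "(p ^ 2) ^ Suc n + (q ^ 2) ^ Suc n \<le> (p\<^sup>2 + q\<^sup>2) ^ Suc n"
    by (intro sum_power_le_power_sum) auto
  hence 3: "p ^ (2 * Suc n) + q ^ (2 * Suc n) \<le> (p\<^sup>2 + q\<^sup>2) ^ Suc n"
    by (simp only: power_mult)
  have "x ^ (2 * Suc n) + real (Suc n) * x ^ (2 * n) * (x * y + y\<^sup>2/4) \<le> (x\<^sup>2 + (x * y + y\<^sup>2/4)) ^ Suc n"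
    using power_tangent_le[of "x\<^sup>2" "x * y + y\<^sup>2/4" n] zero_le_power2[of "x + y / 2"]
    unfolding power_mult power_add power2_sum
    by (simp add: power2_eq_square algebra_simps)
  also have "x\<^sup>2 + (x * y + y\<^sup>2/4) = p\<^sup>2" by (simp add: p_def power2_eq_square algebra_simps)
  finally have 4: "x ^ (2 * Suc n) + real (Suc n) * x ^ (2 * n) * (x * y + y\<^sup>2/4) \<le> p ^ (2 * Suc n)"
    by (simp only: power_mult)
  have 5: "0 \<le> Suc n * x ^ (2 * n) * (y\<^sup>2/4)" by simp
  have "x ^ (2 * Suc n) + real (Suc n) * x ^ (2 * n + 1) * y \<le> p ^ (2 * Suc n)"
    using 4 5 by (simp add: algebra_simps)
  hence "x ^ (2 * Suc n) + 2 * (real (Suc n) * x ^ (2 * n + 1) * y) + 2 * q ^ (2 * Suc n)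
      \<le> (p + q) ^ (2 * Suc n)"
    using 1 2 3 unfolding xpq(1)[symmetric] by linarith
  thus ?B unfolding xpq(2) q_def[symmetric] by (simp only: mult.assoc)
qed

text \<open>The companion of the upper bound. For the induction step, the binomial remainder of \<open>(x\<^sup>2 + b)\<^sup>k\<close> with
\<open>b = e y\<^sup>2\<close> is split into a multiple of \<open>x\<^bsup>2 k - 2\<^esup> y\<^sup>2\<close> and a multiple of \<open>y\<^bsup>2 k\<^esup>\<close>, and each fits into
one half of the corresponding lower bound for the Taylor remainder.\<close>

lemma even_power_add_lower:
  "\<exists>c>0. \<forall>k\<le>m. \<forall>x y :: real.
     2 * real k * x ^ (2 * k - 1) * y + (x\<^sup>2 + c * y\<^sup>2) ^ k \<le> (x + y) ^ (2 * k)"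
proof (induction m)
  case 0
  show ?case by (intro exI[of _ 1]) auto
next
  case (Suc m)
  then obtain c where c: "c > 0" "\<And>k (x :: real) y. k \<le> m \<Longrightarrow>
     2 * real k * x ^ (2 * k - 1) * y + (x\<^sup>2 + c * y\<^sup>2) ^ k \<le> (x + y) ^ (2 * k)"
    by blast
  define K where "K = real (Suc m)"
  \<comment> \<open>small enough that the factor \<open>K * e * 2 ^ m\<close> arising below is half of \<open>(1/2)\<^bsup>2 (m + 1)\<^esup>\<close>\<close>
  define e where "e = 1 / (K * 8 ^ Suc m)"
  have K: "K \<ge> 1" by (simp add: K_def)
  have e: "e > 0" using K by (simp add: e_def)
  have "(1::real) \<le> K * 8 ^ Suc m"
    using mult_mono[OF K one_le_power[of "8::real" "Suc m"]] K by simp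
  hence e1: "e \<le> 1" by (simp add: e_def)
  have Ke: "K * e * 2 ^ m = (1/4) ^ Suc m / 2"
    using K by (simp add: e_def power_divide field_simps flip: power_mult_distrib)
  define c' where "c' = min c e"
  show ?case
  proof (intro exI[of _ c'] conjI allI impI)
    show "c' > 0" using c e by (simp add: c'_def)
    fix k and x y :: real assume k: "k \<le> Suc m"
    show "2 * real k * x ^ (2 * k - 1) * y + (x\<^sup>2 + c' * y\<^sup>2) ^ k \<le> (x + y) ^ (2 * k)"
    proof (cases "k \<le> m")
      case True
      have "(x\<^sup>2 + c' * y\<^sup>2) ^ k \<le> (x\<^sup>2 + c * y\<^sup>2) ^ k"
        using c e by (intro power_mono add_left_mono mult_right_mono) (auto simp: c'_def)
      with c(2)[OF True, of x y] show ?thesis by simp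
    next
      case False
      with k have k: "k = Suc m" by simp
      define b where "b = e * y\<^sup>2"
      have b: "b \<ge> 0" using e by (simp add: b_def)
      have ypow: "(y / 2) ^ (2 * Suc m) = (1/4) ^ Suc m * (y\<^sup>2) ^ Suc m"
        unfolding power_mult power_mult_distrib[symmetric] by (simp add: power_divide)
      have "(x\<^sup>2 + c' * y\<^sup>2) ^ Suc m \<le> (x\<^sup>2 + b) ^ Suc m"
        unfolding b_def using c e by (intro power_mono add_left_mono mult_right_mono) (auto simp: c'_def)
      also have "\<dots> \<le> (x\<^sup>2) ^ Suc m + K * (x\<^sup>2 + b) ^ m * b"
        using power_tangent_le[of "x\<^sup>2 + b" "- b" m] b by (simp add: K_def)
      also have "K * (x\<^sup>2 + b) ^ m * b \<le> K * (2 ^ m * ((x\<^sup>2) ^ m + b ^ m)) * b"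
        using K b by (intro mult_right_mono mult_left_mono power_sum_le_two_power) auto
      also have "\<dots> = K * e * 2 ^ m * ((x\<^sup>2) ^ m * y\<^sup>2 + e ^ m * (y\<^sup>2) ^ Suc m)"
        by (simp add: b_def power_mult_distrib algebra_simps)
      also have "\<dots> \<le> K * e * 2 ^ m * ((x\<^sup>2) ^ m * y\<^sup>2 + 1 * (y\<^sup>2) ^ Suc m)"
        using K e e1 by (intro mult_left_mono add_left_mono mult_right_mono power_le_one) auto
      also have "\<dots> = (1/4) ^ Suc m / 2 * (x\<^sup>2) ^ m * y\<^sup>2 + (y / 2) ^ (2 * Suc m) / 2"
        unfolding Ke ypow by (simp add: algebra_simps)
      also have "(1/4) ^ Suc m / 2 * (x\<^sup>2) ^ m * y\<^sup>2 \<le> K / 2 * (x\<^sup>2) ^ m * y\<^sup>2"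
        using K power_le_one[of "1/4 :: real" "Suc m"] by (intro mult_right_mono) auto
      finally have 1: "(x\<^sup>2 + c' * y\<^sup>2) ^ Suc m \<le>
          (x\<^sup>2) ^ Suc m + K / 2 * (x\<^sup>2) ^ m * y\<^sup>2 + (y / 2) ^ (2 * Suc m) / 2"
        by simp
      have 2: "0 \<le> (y / 2) ^ (2 * Suc m)"
        by (rule zero_le_even_power) simp
      have 3: "(x\<^sup>2) ^ Suc m + K * (x\<^sup>2) ^ m * y\<^sup>2 + 2 * K * x ^ (2 * m + 1) * y \<le> (x + y) ^ (2 * Suc m)"
        using even_power_add_ge_parts(1)[of x m y] unfolding power_mult K_def by simp
      have 4: "(x\<^sup>2) ^ Suc m + 2 * (y / 2) ^ (2 * Suc m) + 2 * K * x ^ (2 * m + 1) * y \<le> (x + y) ^ (2 * Suc m)"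
        using even_power_add_ge_parts(2)[of x m y] unfolding power_mult K_def by simp
      show ?thesis using 1 2 3 4 unfolding k by (simp add: K_def)
    qed
  qed
qed

section \<open>Moments and independence\<close>

context prob_space
begin

text \<open>Membership in \<open>L\<^sup>p\<close> of the underlying probability space, kept as a predicate on functions so that powers
of the exponent and of the function can be exchanged freely.\<close>

definition finite_moment :: "nat \<Rightarrow> ('a \<Rightarrow> real) \<Rightarrow> bool" where
  "finite_moment p U \<longleftrightarrow> U \<in> borel_measurable M \<and> integrable M (\<lambda>\<omega>. \<bar>U \<omega>\<bar> ^ p)"

lemma finite_moment_measurable: "finite_moment p U \<Longrightarrow> U \<in> borel_measurable M"
  by (simp add: finite_moment_def)

lemma finite_moment_mono:
  assumes U: "finite_moment p U" and "q \<le> p"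
  shows "finite_moment q U"
  unfolding finite_moment_def
proof
  show [measurable]: "U \<in> borel_measurable M" using U by (rule finite_moment_measurable)
  have 1: "AE \<omega> in M. norm (\<bar>U \<omega>\<bar> ^ q) \<le> norm (1 + \<bar>U \<omega>\<bar> ^ p)"
    by (intro AE_I2) (simp add: power_le_one_plus_power \<open>q \<le> p\<close>)
  have 2: "integrable M (\<lambda>\<omega>. 1 + \<bar>U \<omega>\<bar> ^ p)"
    using U by (simp add: finite_moment_def)
  show "integrable M (\<lambda>\<omega>. \<bar>U \<omega>\<bar> ^ q)"
    by (rule Bochner_Integration.integrable_bound[OF 2 _ 1]) simp
qed

lemma finite_moment_bound:
  assumes U: "finite_moment p U" and [measurable]: "V \<in> borel_measurable M"
    and le: "\<And>\<omega>. \<omega> \<in> space M \<Longrightarrow> \<bar>V \<omega>\<bar> \<le> \<bar>U \<omega>\<bar>"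
  shows "finite_moment p V"
  unfolding finite_moment_def
proof
  show "integrable M (\<lambda>\<omega>. \<bar>V \<omega>\<bar> ^ p)"
  proof (rule Bochner_Integration.integrable_bound)
    show "integrable M (\<lambda>\<omega>. \<bar>U \<omega>\<bar> ^ p)" using U by (simp add: finite_moment_def)
    show "AE \<omega> in M. norm (\<bar>V \<omega>\<bar> ^ p) \<le> norm (\<bar>U \<omega>\<bar> ^ p)"
      by (rule AE_I2) (simp add: power_mono le)
  qed simp
qed fact

lemma finite_moment_const [simp]: "finite_moment p (\<lambda>_. c)"
  by (simp add: finite_moment_def)

lemma finite_moment_abs:
  assumes "finite_moment p U"
  shows "finite_moment p (\<lambda>\<omega>. \<bar>U \<omega>\<bar>)"
  using assms by (auto simp: finite_moment_def)

lemma finite_moment_cmult: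
  assumes "finite_moment p U"
  shows "finite_moment p (\<lambda>\<omega>. c * U \<omega>)"
  using assms by (auto simp: finite_moment_def abs_mult power_mult_distrib)

lemma finite_moment_add:
  assumes U: "finite_moment p U" and V: "finite_moment p V"
  shows "finite_moment p (\<lambda>\<omega>. U \<omega> + V \<omega>)"
  unfolding finite_moment_def
proof
  have [measurable]: "U \<in> borel_measurable M" "V \<in> borel_measurable M"
    using assms by (auto dest: finite_moment_measurable)
  show "(\<lambda>\<omega>. U \<omega> + V \<omega>) \<in> borel_measurable M" by simp
  have "\<bar>x + y\<bar> ^ p \<le> 2 ^ p * (\<bar>x\<bar> ^ p + \<bar>y\<bar> ^ p)" for x y :: real
    using power_mono[OF abs_triangle_ineq[of x y], of p] power_sum_le_two_power[of "\<bar>x\<bar>" "\<bar>y\<bar>" p] by simp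
  then have 1: "AE \<omega> in M. norm (\<bar>U \<omega> + V \<omega>\<bar> ^ p) \<le> norm (2 ^ p * (\<bar>U \<omega>\<bar> ^ p + \<bar>V \<omega>\<bar> ^ p))"
    by (intro AE_I2) simp
  have 2: "integrable M (\<lambda>\<omega>. 2 ^ p * (\<bar>U \<omega>\<bar> ^ p + \<bar>V \<omega>\<bar> ^ p))"
    using U V by (simp add: finite_moment_def)
  show "integrable M (\<lambda>\<omega>. \<bar>U \<omega> + V \<omega>\<bar> ^ p)"
    by (rule Bochner_Integration.integrable_bound[OF 2 _ 1]) simp
qed

lemma finite_moment_diff:
  assumes "finite_moment p U" "finite_moment p V"
  shows "finite_moment p (\<lambda>\<omega>. U \<omega> - V \<omega>)"
  using finite_moment_add[OF assms(1) finite_moment_cmult[OF assms(2), of "-1"]] by simp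

lemma finite_moment_sum:
  assumes "\<And>i. i \<in> I \<Longrightarrow> finite_moment p (U i)"
  shows "finite_moment p (\<lambda>\<omega>. \<Sum>i\<in>I. U i \<omega>)"
  using assms
proof (induction I rule: infinite_finite_induct)
  case (insert i I)
  have "finite_moment p (\<lambda>\<omega>. U i \<omega> + (\<Sum>i\<in>I. U i \<omega>))"
    by (rule finite_moment_add[OF insert.prems[OF insertI1] insert.IH[OF insert.prems[OF insertI2]]])
  thus ?case by (simp only: sum.insert[OF insert.hyps])
qed simp_all

lemma finite_moment_power:
  assumes "finite_moment (k * p) U"
  shows "finite_moment p (\<lambda>\<omega>. U \<omega> ^ k)"
proof -
  have "U \<in> borel_measurable M" and 2: "integrable M (\<lambda>\<omega>. \<bar>U \<omega>\<bar> ^ (k * p))"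
    using assms by (simp_all only: finite_moment_def)
  from this(1) have 1: "(\<lambda>\<omega>. U \<omega> ^ k) \<in> borel_measurable M" by (rule borel_measurable_power)
  show ?thesis unfolding finite_moment_def power_abs using 1 2 by (simp only: power_mult)
qed

lemma finite_moment_integrable:
  assumes "finite_moment p U" "1 \<le> p"
  shows "integrable M U"
proof (rule integrable_abs_cancel)
  show "integrable M (\<lambda>\<omega>. \<bar>U \<omega>\<bar>)" "U \<in> borel_measurable M"
    using finite_moment_mono[OF assms] by (simp_all add: finite_moment_def)
qed

lemma finite_moment_integrable_mult:
  assumes U: "finite_moment p U" and V: "finite_moment p V" and "i + j \<le> p"
  shows "integrable M (\<lambda>\<omega>. U \<omega> ^ i * V \<omega> ^ j)"
proof -
  have [measurable]: "U \<in> borel_measurable M" "V \<in> borel_measurable M"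
    using assms by (auto dest: finite_moment_measurable)
  have "finite_moment p (\<lambda>\<omega>. \<bar>U \<omega>\<bar> + \<bar>V \<omega>\<bar>)"
    by (intro finite_moment_add finite_moment_abs U V)
  hence 1: "integrable M (\<lambda>\<omega>. (\<bar>U \<omega>\<bar> + \<bar>V \<omega>\<bar>) ^ (i + j))"
    using finite_moment_mono[OF _ \<open>i + j \<le> p\<close>, of "\<lambda>\<omega>. \<bar>U \<omega>\<bar> + \<bar>V \<omega>\<bar>"] by (simp add: finite_moment_def)
  have "\<bar>x ^ i * y ^ j\<bar> \<le> \<bar>(\<bar>x\<bar> + \<bar>y\<bar>) ^ (i + j)\<bar>" for x y :: real
    unfolding power_add abs_mult power_abs by (intro mult_mono power_mono) auto
  thus ?thesis
    by (intro Bochner_Integration.integrable_bound[OF 1] AE_I2) simp_all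
qed

lemma finite_moment_integrable_power:
  assumes "finite_moment p U" "i \<le> p"
  shows "integrable M (\<lambda>\<omega>. U \<omega> ^ i)"
  using finite_moment_integrable_mult[OF assms(1) finite_moment_const, of i 0 1] assms(2) by simp

text \<open>By Fubini the translate \<open>U + v\<close> lies in \<open>L\<^sup>p\<close> for almost every value \<open>v\<close> of \<open>V\<close>. This is how moments of
the normalized sums are passed on to the single summands.\<close>

lemma finite_moment_if_indep_sum:
  assumes ind: "indep_var borel U borel V" and UV: "finite_moment p (\<lambda>\<omega>. U \<omega> + V \<omega>)"
  shows "finite_moment p U"
proof -
  note [measurable] = indep_var_rv1[OF ind] indep_var_rv2[OF ind]
  let ?P = "distr M borel U" and ?Q = "distr M borel V"
  interpret P: prob_space ?P by (rule prob_space_distr) simp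
  interpret Q: prob_space ?Q by (rule prob_space_distr) simp
  interpret PQ: pair_prob_space ?P ?Q ..
  have int: "integrable (?P \<Otimes>\<^sub>M ?Q) (\<lambda>(u, v). \<bar>u + v\<bar> ^ p)"
    using UV unfolding indep_var_distribution_eq[THEN iffD1, OF ind, THEN conjunct2, THEN conjunct2]
    by (subst integrable_distr_eq) (auto simp: finite_moment_def)
  interpret QP: pair_prob_space ?Q ?P ..
  from QP.AE_integrable_fst'[OF PQ.integrable_product_swap[OF int]]
  have "AE v in ?Q. integrable ?P (\<lambda>u. \<bar>u + v\<bar> ^ p)" by simp
  then obtain v where v: "integrable ?P (\<lambda>u. \<bar>u + v\<bar> ^ p)"
    using eventually_happens'[OF Q.ae_filter_bot] by blast
  hence "finite_moment p (\<lambda>\<omega>. U \<omega> + v)"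
    by (subst (asm) integrable_distr_eq) (auto simp: finite_moment_def)
  from finite_moment_diff[OF this finite_moment_const[of p v]] show ?thesis by simp
qed

lemma expectation_indep_binomial:
  assumes ind: "indep_var borel U borel V" and U: "finite_moment n U" and V: "finite_moment n V"
  shows "expectation (\<lambda>\<omega>. (U \<omega> + V \<omega>) ^ n) =
    (\<Sum>k\<le>n. real (n choose k) * expectation (\<lambda>\<omega>. U \<omega> ^ k) * expectation (\<lambda>\<omega>. V \<omega> ^ (n - k)))"
proof -
  have "expectation (\<lambda>\<omega>. (U \<omega> + V \<omega>) ^ n) =
    expectation (\<lambda>\<omega>. \<Sum>k\<le>n. real (n choose k) * (U \<omega> ^ k * V \<omega> ^ (n - k)))"
    by (simp add: binomial_ring mult.assoc)
  also have "\<dots> = (\<Sum>k\<le>n. real (n choose k) * expectation (\<lambda>\<omega>. U \<omega> ^ k * V \<omega> ^ (n - k)))"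
    by (subst Bochner_Integration.integral_sum)
       (auto intro!: finite_moment_integrable_mult[OF U V])
  also have "\<dots> = (\<Sum>k\<le>n. real (n choose k) * (expectation (\<lambda>\<omega>. U \<omega> ^ k) * expectation (\<lambda>\<omega>. V \<omega> ^ (n - k))))"
  proof (intro sum.cong refl arg_cong2[where f = "(*)"] indep_var_lebesgue_integral)
    fix k assume "k \<in> {..n}"
    hence k: "k \<le> n" by simp
    show "indep_var borel (\<lambda>\<omega>. U \<omega> ^ k) borel (\<lambda>\<omega>. V \<omega> ^ (n - k))"
      using indep_var_compose[OF ind, of "\<lambda>x. x ^ k" borel "\<lambda>x. x ^ (n - k)" borel]
      by (simp add: comp_def)
    show "integrable M (\<lambda>\<omega>. U \<omega> ^ k)" "integrable M (\<lambda>\<omega>. V \<omega> ^ (n - k))"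
      using k by (auto intro: finite_moment_integrable_power[OF U] finite_moment_integrable_power[OF V])
  qed
  finally show ?thesis by (simp add: mult.assoc)
qed

text \<open>Used to compare nonnegative variables by all moments up to order \<open>m\<close>. The point of including all lower
orders is that the relation is then compatible with sums of independent variables, by the binomial
formula.\<close>

definition moments_le :: "nat \<Rightarrow> ('a \<Rightarrow> real) \<Rightarrow> ('a \<Rightarrow> real) \<Rightarrow> bool" where
  "moments_le m U V \<longleftrightarrow> (\<forall>k\<le>m. expectation (\<lambda>\<omega>. U \<omega> ^ k) \<le> expectation (\<lambda>\<omega>. V \<omega> ^ k))"

lemma moments_leD: "moments_le m U V \<Longrightarrow> k \<le> m \<Longrightarrow> expectation (\<lambda>\<omega>. U \<omega> ^ k) \<le> expectation (\<lambda>\<omega>. V \<omega> ^ k)"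
  by (simp add: moments_le_def)

lemma moments_le_trans [trans]: "moments_le m U V \<Longrightarrow> moments_le m V W \<Longrightarrow> moments_le m U W"
  unfolding moments_le_def by (meson order_trans)

lemma moments_le_refl: "moments_le m U U"
  by (simp add: moments_le_def)

lemma moments_le_cmult:
  assumes "moments_le m U V" "0 \<le> c"
  shows "moments_le m (\<lambda>\<omega>. c * U \<omega>) (\<lambda>\<omega>. c * V \<omega>)"
  using assms by (simp add: moments_le_def power_mult_distrib mult_left_mono)

lemma moments_le_mono:
  assumes "finite_moment m V" "U \<in> borel_measurable M" "\<And>\<omega>. 0 \<le> U \<omega>" "\<And>\<omega>. U \<omega> \<le> V \<omega>"
  shows "moments_le m U V"
  unfolding moments_le_def
proof (intro allI impI integral_mono)
  fix k assume k: "k \<le> m"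
  show "integrable M (\<lambda>\<omega>. V \<omega> ^ k)" using assms k by (intro finite_moment_integrable_power)
  have "finite_moment m U"
    using assms(3,4) by (intro finite_moment_bound[OF assms(1,2)]) (smt (verit))
  thus "integrable M (\<lambda>\<omega>. U \<omega> ^ k)" using k by (intro finite_moment_integrable_power)
qed (auto intro: power_mono assms)

lemma moments_le_indep_add:
  assumes "indep_var borel U borel V" "indep_var borel U' borel V'"
    and fm: "finite_moment m U" "finite_moment m V" "finite_moment m U'" "finite_moment m V'"
    and nn: "\<And>\<omega>. 0 \<le> U \<omega>" "\<And>\<omega>. 0 \<le> V \<omega>" "\<And>\<omega>. 0 \<le> U' \<omega>" "\<And>\<omega>. 0 \<le> V' \<omega>"
    and le: "moments_le m U U'" "moments_le m V V'"
  shows "moments_le m (\<lambda>\<omega>. U \<omega> + V \<omega>) (\<lambda>\<omega>. U' \<omega> + V' \<omega>)"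
  unfolding moments_le_def
proof (intro allI impI)
  fix k assume k: "k \<le> m"
  show "expectation (\<lambda>\<omega>. (U \<omega> + V \<omega>) ^ k) \<le> expectation (\<lambda>\<omega>. (U' \<omega> + V' \<omega>) ^ k)"
    unfolding expectation_indep_binomial[OF assms(1) finite_moment_mono[OF fm(1) k] finite_moment_mono[OF fm(2) k]]
      expectation_indep_binomial[OF assms(2) finite_moment_mono[OF fm(3) k] finite_moment_mono[OF fm(4) k]]
    unfolding mult.assoc
    using k by (intro sum_mono mult_left_mono mult_mono moments_leD[OF le(1)] moments_leD[OF le(2)]
          Bochner_Integration.integral_nonneg zero_le_power nn) auto
qed

text \<open>Independence of the past \<open>X\<^sub>1, \<dots>, X\<^sub>n\<close> and the next variable, in the form used in every induction over the
number of summands. Writing the past as a function \<open>F\<close> of the restricted family makes its dependence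
on the first \<open>n\<close> variables explicit.\<close>

lemma indep_var_of_initial_segment:
  fixes X :: "nat \<Rightarrow> 'a \<Rightarrow> real"
  assumes ind: "indep_vars (\<lambda>_. borel) X {1..}"
    and F: "F \<in> measurable (PiM {1..n} (\<lambda>_. borel)) N" and f: "f \<in> measurable borel N'"
    and U: "\<And>\<omega>. U \<omega> = F (restrict (\<lambda>i. X i \<omega>) {1..n})"
  shows "indep_var N U N' (\<lambda>\<omega>. f (X (Suc n) \<omega>))"
proof -
  have "indep_var (PiM {1..n} (\<lambda>_. borel)) (\<lambda>\<omega>. restrict (\<lambda>i. X i \<omega>) {1..n})
      (PiM {Suc n} (\<lambda>_. borel)) (\<lambda>\<omega>. restrict (\<lambda>i. X i \<omega>) {Suc n})"
    by (rule indep_var_restrict[OF ind]) auto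
  from indep_var_compose[OF this F, of "\<lambda>x. f (x (Suc n))" N']
  moreover have "U = F \<circ> (\<lambda>\<omega>. restrict (\<lambda>i. X i \<omega>) {1..n})" using U by auto
  ultimately show ?thesis using f by (simp add: comp_def)
qed

lemma expectation_indep_Fubini:
  fixes h :: "'b \<times> 'b \<Rightarrow> real"
  assumes ind: "indep_var N A N' B" and [measurable]: "h \<in> borel_measurable (N \<Otimes>\<^sub>M N')"
    and int: "integrable M (\<lambda>\<omega>. h (A \<omega>, B \<omega>))"
  shows "expectation (\<lambda>\<omega>. expectation (\<lambda>\<omega>'. h (A \<omega>, B \<omega>'))) = expectation (\<lambda>\<omega>. h (A \<omega>, B \<omega>))"
proof -
  note rv [measurable] = indep_var_rv1[OF ind] indep_var_rv2[OF ind]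
  let ?A = "distr M N A" and ?B = "distr M N' B"
  interpret A: prob_space ?A by (rule prob_space_distr) simp
  interpret B: prob_space ?B by (rule prob_space_distr) simp
  interpret AB: pair_prob_space ?A ?B ..
  have eq: "?A \<Otimes>\<^sub>M ?B = distr M (N \<Otimes>\<^sub>M N') (\<lambda>\<omega>. (A \<omega>, B \<omega>))"
    using indep_var_distribution_eq[THEN iffD1, OF ind] by simp
  have int': "integrable (?A \<Otimes>\<^sub>M ?B) h"
    unfolding eq using int by (subst integrable_distr_eq) auto
  have "expectation (\<lambda>\<omega>. h (A \<omega>, B \<omega>)) = integral\<^sup>L (?A \<Otimes>\<^sub>M ?B) h"
    unfolding eq by (subst integral_distr) auto
  also have "\<dots> = (\<integral>a. (\<integral>b. h (a, b) \<partial>?B) \<partial>?A)"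
    by (rule AB.integral_fst'[OF int', symmetric])
  also have "\<dots> = expectation (\<lambda>\<omega>. \<integral>b. h (A \<omega>, b) \<partial>?B)"
    by (subst integral_distr) auto
  also have "\<dots> = expectation (\<lambda>\<omega>. expectation (\<lambda>\<omega>'. h (A \<omega>, B \<omega>')))"
  proof (intro Bochner_Integration.integral_cong refl)
    fix \<omega> assume "\<omega> \<in> space M"
    hence [simp]: "A \<omega> \<in> space N" using measurable_space[OF rv(1)] by blast
    show "(\<integral>b. h (A \<omega>, b) \<partial>?B) = expectation (\<lambda>\<omega>'. h (A \<omega>, B \<omega>'))"
      by (subst integral_distr) auto
  qed
  finally show ?thesis ..
qed

end

section \<open>Sums of squares of independent centred variables\<close>

locale indep_finite_moments = prob_space +
  fixes X :: "nat \<Rightarrow> 'a \<Rightarrow> real" and m :: nat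
  assumes indep: "indep_vars (\<lambda>_. borel) X {1..}"
    and fm: "\<And>n. 1 \<le> n \<Longrightarrow> finite_moment (2 * m) (X n)"
    and m: "1 \<le> m"
begin

definition centred :: "nat \<Rightarrow> 'a \<Rightarrow> real" where
  "centred n \<omega> = X n \<omega> - expectation (X n)"

lemma finite_moment_centred: "1 \<le> n \<Longrightarrow> finite_moment (2 * m) (centred n)"
  unfolding centred_def by (intro finite_moment_diff fm finite_moment_const)

lemma expectation_centred: "1 \<le> n \<Longrightarrow> expectation (centred n) = 0"
  unfolding centred_def using finite_moment_integrable[OF fm] m by (simp add: prob_space)

lemma finite_moment_sum_squares:
  "finite_moment m (\<lambda>\<omega>. \<Sum>j=1..n. c j * (centred j \<omega>)\<^sup>2)"
  by (intro finite_moment_sum finite_moment_cmult finite_moment_power)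
     (auto intro: finite_moment_centred)

lemma indep_sum_squares:
  "indep_var borel (\<lambda>\<omega>. \<Sum>j=1..n. c j * (centred j \<omega>)\<^sup>2) borel (\<lambda>\<omega>. c' * (centred (Suc n) \<omega>)\<^sup>2)"
proof -
  have "indep_var borel (\<lambda>\<omega>. \<Sum>j=1..n. c j * (X j \<omega> - expectation (X j))\<^sup>2) borel
     (\<lambda>\<omega>. (\<lambda>x. c' * (x - expectation (X (Suc n)))\<^sup>2) (X (Suc n) \<omega>))"
    by (rule indep_var_of_initial_segment[OF indep, where
          F = "\<lambda>x. \<Sum>j=1..n. c j * (x j - expectation (X j))\<^sup>2"]) auto
  thus ?thesis by (simp add: centred_def)
qed

text \<open>A reverse Marcinkiewicz-Zygmund inequality. In the induction step the new variable is independent of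
the sum so far and centred, so the linear term of \<open>even_power_add_lower\<close> has mean zero.\<close>

lemma sum_squares_moments_le_square_sum:
  "\<exists>c>0. \<forall>n. moments_le m (\<lambda>\<omega>. \<Sum>j=1..n. c * (centred j \<omega>)\<^sup>2) (\<lambda>\<omega>. (\<Sum>j=1..n. centred j \<omega>)\<^sup>2)"
proof -
  obtain c where c: "c > 0" "\<And>k (x::real) y. k \<le> m \<Longrightarrow>
     2 * real k * x ^ (2 * k - 1) * y + (x\<^sup>2 + c * y\<^sup>2) ^ k \<le> (x + y) ^ (2 * k)"
    using even_power_add_lower[of m] by blast
  have "moments_le m (\<lambda>\<omega>. \<Sum>j=1..n. c * (centred j \<omega>)\<^sup>2) (\<lambda>\<omega>. (\<Sum>j=1..n. centred j \<omega>)\<^sup>2)" for n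
  proof (induction n)
    case 0
    show ?case by (simp add: moments_le_def)
  next
    case (Suc n)
    let ?S = "\<lambda>\<omega>. \<Sum>j=1..n. centred j \<omega>" and ?x = "centred (Suc n)"
    have fS: "finite_moment (2 * m) ?S"
      by (intro finite_moment_sum finite_moment_centred) auto
    have fx: "finite_moment (2 * m) ?x" by (intro finite_moment_centred) auto
    have ind: "indep_var borel (\<lambda>\<omega>. f (?S \<omega>)) borel (\<lambda>\<omega>. g (?x \<omega>))"
      if [measurable]: "f \<in> borel_measurable borel" "g \<in> borel_measurable borel" for f g :: "real \<Rightarrow> real"
    proof -
      have "indep_var borel (\<lambda>\<omega>. f (\<Sum>j=1..n. X j \<omega> - expectation (X j))) borel
        (\<lambda>\<omega>. (\<lambda>x. g (x - expectation (X (Suc n)))) (X (Suc n) \<omega>))"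
        by (rule indep_var_of_initial_segment[OF indep, where
             F = "\<lambda>x. f (\<Sum>j=1..n. x j - expectation (X j))"]) auto
      thus ?thesis by (simp add: centred_def)
    qed
    have "moments_le m (\<lambda>\<omega>. (\<Sum>j=1..n. c * (centred j \<omega>)\<^sup>2) + c * (?x \<omega>)\<^sup>2) (\<lambda>\<omega>. (?S \<omega>)\<^sup>2 + c * (?x \<omega>)\<^sup>2)"
    proof (rule moments_le_indep_add[OF indep_sum_squares _ finite_moment_sum_squares])
      show "indep_var borel (\<lambda>\<omega>. (?S \<omega>)\<^sup>2) borel (\<lambda>\<omega>. c * (?x \<omega>)\<^sup>2)" by (rule ind) auto
      show "finite_moment m (\<lambda>\<omega>. (?S \<omega>)\<^sup>2)" "finite_moment m (\<lambda>\<omega>. c * (?x \<omega>)\<^sup>2)" "finite_moment m (\<lambda>\<omega>. c * (?x \<omega>)\<^sup>2)"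
        by (intro finite_moment_power finite_moment_cmult fS fx)+
    qed (use c Suc in \<open>auto intro!: sum_nonneg moments_le_refl\<close>)
    also have "moments_le m (\<lambda>\<omega>. (?S \<omega>)\<^sup>2 + c * (?x \<omega>)\<^sup>2) (\<lambda>\<omega>. (?S \<omega> + ?x \<omega>)\<^sup>2)"
      unfolding moments_le_def
    proof (intro allI impI)
      fix k assume k: "k \<le> m"
      have int1: "integrable M (\<lambda>\<omega>. ?S \<omega> ^ (2 * k - 1) * ?x \<omega>)"
        using finite_moment_integrable_mult[OF fS fx, of "2 * k - 1" 1] k m by simp
      have int2: "integrable M (\<lambda>\<omega>. ((?S \<omega>)\<^sup>2 + c * (?x \<omega>)\<^sup>2) ^ k)"
        by (rule finite_moment_integrable_power[OF finite_moment_add k])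
           (intro finite_moment_power finite_moment_cmult fS fx)+
      have int3: "integrable M (\<lambda>\<omega>. (?S \<omega> + ?x \<omega>) ^ (2 * k))"
        using k by (intro finite_moment_integrable_power[OF finite_moment_add[OF fS fx]]) simp
      have "expectation (\<lambda>\<omega>. ?S \<omega> ^ (2 * k - 1) * ?x \<omega>) = expectation (\<lambda>\<omega>. ?S \<omega> ^ (2 * k - 1)) * expectation ?x"
      proof (rule indep_var_lebesgue_integral)
        show "indep_var borel (\<lambda>\<omega>. ?S \<omega> ^ (2 * k - 1)) borel ?x"
          by (rule ind[of "\<lambda>x. x ^ (2 * k - 1)" "\<lambda>x. x"]) measurable
        show "integrable M (\<lambda>\<omega>. ?S \<omega> ^ (2 * k - 1))"
          by (rule finite_moment_integrable_power[OF fS]) (use k in simp)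
        show "integrable M ?x" by (rule finite_moment_integrable[OF fx]) (use m in simp)
      qed
      hence "expectation (\<lambda>\<omega>. ?S \<omega> ^ (2 * k - 1) * ?x \<omega>) = 0" by (simp only: expectation_centred)
      hence "expectation (\<lambda>\<omega>. ((?S \<omega>)\<^sup>2 + c * (?x \<omega>)\<^sup>2) ^ k) =
        expectation (\<lambda>\<omega>. 2 * real k * (?S \<omega> ^ (2 * k - 1) * ?x \<omega>) + ((?S \<omega>)\<^sup>2 + c * (?x \<omega>)\<^sup>2) ^ k)"
        using int1 int2 by simp
      also have "\<dots> \<le> expectation (\<lambda>\<omega>. (?S \<omega> + ?x \<omega>) ^ (2 * k))"
        using c(2)[OF k] int1 int2 int3 by (intro integral_mono) (auto simp: mult.assoc)
      finally show "expectation (\<lambda>\<omega>. ((?S \<omega>)\<^sup>2 + c * (?x \<omega>)\<^sup>2) ^ k) \<le> expectation (\<lambda>\<omega>. ((?S \<omega> + ?x \<omega>)\<^sup>2) ^ k)"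
        by (simp add: power_mult)
    qed
    finally show ?case by simp
  qed
  thus ?thesis using c by blast
qed

end

section \<open>Moments of Lipschitz functionals of a random walk\<close>

context prob_space begin

lemma finite_moment_lipschitz:
  fixes \<phi> :: "real \<Rightarrow> real"
  assumes U: "finite_moment p U" and \<phi>: "L-lipschitz_on UNIV \<phi>"
  shows "finite_moment p (\<lambda>\<omega>. \<phi> (U \<omega>))"
proof (rule finite_moment_bound)
  show "finite_moment p (\<lambda>\<omega>. \<bar>\<phi> 0\<bar> + L * \<bar>U \<omega>\<bar>)"
    by (rule finite_moment_add[OF finite_moment_const finite_moment_cmult[OF finite_moment_abs[OF U]]])
  have [measurable]: "\<phi> \<in> borel_measurable borel"
    by (intro borel_measurable_continuous_onI lipschitz_on_continuous_on[OF \<phi>])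
  have [measurable]: "U \<in> borel_measurable M" by (rule finite_moment_measurable[OF U])
  show "(\<lambda>\<omega>. \<phi> (U \<omega>)) \<in> borel_measurable M" by simp
  fix \<omega>
  have "\<bar>\<phi> (U \<omega>) - \<phi> 0\<bar> \<le> L * \<bar>U \<omega>\<bar>"
    using lipschitz_onD[OF \<phi>, of "U \<omega>" 0] by (simp add: dist_real_def)
  thus "\<bar>\<phi> (U \<omega>)\<bar> \<le> \<bar>\<bar>\<phi> 0\<bar> + L * \<bar>U \<omega>\<bar>\<bar>" by linarith
qed

lemma expectation_power_Jensen:
  assumes U: "finite_moment n U" and n: "even n" "1 \<le> n"
  shows "(expectation U) ^ n \<le> expectation (\<lambda>\<omega>. U \<omega> ^ n)"
  using jensens_inequality[of U UNIV undefined undefined "\<lambda>x. x ^ n"]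
    finite_moment_integrable[OF U n(2)] finite_moment_integrable_power[OF U order_refl] convex_power_even[OF n(1)]
  by simp

text \<open>Adding the constant \<open>E \<bar>U\<bar>\<close> is harmless because, by Jensen's inequality, its powers are bounded by the
moments of \<open>U\<close>.\<close>

lemma moments_le_square_shift_by_absolute_mean:
  assumes U: "finite_moment (2 * m) U"
  shows "moments_le m (\<lambda>\<omega>. (\<bar>U \<omega>\<bar> + expectation (\<lambda>\<omega>. \<bar>U \<omega>\<bar>))\<^sup>2) (\<lambda>\<omega>. 8 * (U \<omega>)\<^sup>2)"
  unfolding moments_le_def
proof (intro allI impI)
  fix k assume k: "k \<le> m"
  define e where "e = expectation (\<lambda>\<omega>. \<bar>U \<omega>\<bar>)"
  have e: "e \<ge> 0" by (simp add: e_def)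
  have U': "finite_moment (2 * k) (\<lambda>\<omega>. \<bar>U \<omega>\<bar>)"
    using k by (intro finite_moment_mono[OF finite_moment_abs[OF U]]) simp
  have int: "integrable M (\<lambda>\<omega>. \<bar>U \<omega>\<bar> ^ (2 * k))"
    by (rule finite_moment_integrable_power[OF U']) simp
  show "expectation (\<lambda>\<omega>. ((\<bar>U \<omega>\<bar> + expectation (\<lambda>\<omega>. \<bar>U \<omega>\<bar>))\<^sup>2) ^ k) \<le> expectation (\<lambda>\<omega>. (8 * (U \<omega>)\<^sup>2) ^ k)"
  proof (cases "k = 0")
    case False
    have "expectation (\<lambda>\<omega>. (\<bar>U \<omega>\<bar> + e) ^ (2 * k)) \<le> expectation (\<lambda>\<omega>. 2 ^ (2 * k) * (\<bar>U \<omega>\<bar> ^ (2 * k) + e ^ (2 * k)))"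
    proof (intro integral_mono power_sum_le_two_power)
      show "integrable M (\<lambda>\<omega>. (\<bar>U \<omega>\<bar> + e) ^ (2 * k))"
        by (rule finite_moment_integrable_power[OF finite_moment_add[OF U' finite_moment_const]]) simp
      show "integrable M (\<lambda>\<omega>. 2 ^ (2 * k) * (\<bar>U \<omega>\<bar> ^ (2 * k) + e ^ (2 * k)))"
        using int by (intro integrable_mult_right Bochner_Integration.integrable_add) auto
    qed (use e in auto)
    also have "\<dots> = 2 ^ (2 * k) * (expectation (\<lambda>\<omega>. \<bar>U \<omega>\<bar> ^ (2 * k)) + e ^ (2 * k))"
      using int by (simp add: prob_space)
    also have "e ^ (2 * k) \<le> expectation (\<lambda>\<omega>. \<bar>U \<omega>\<bar> ^ (2 * k))"
      unfolding e_def using False by (intro expectation_power_Jensen U') auto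
    also have "2 ^ (2 * k) * (expectation (\<lambda>\<omega>. \<bar>U \<omega>\<bar> ^ (2 * k)) + expectation (\<lambda>\<omega>. \<bar>U \<omega>\<bar> ^ (2 * k))) =
        4 ^ k * 2 * expectation (\<lambda>\<omega>. (U \<omega>) ^ (2 * k))"
      by (simp add: power_mult power_even_abs)
    also have "\<dots> \<le> 4 ^ k * 2 ^ k * expectation (\<lambda>\<omega>. (U \<omega>) ^ (2 * k))"
      using False by (intro mult_right_mono mult_left_mono self_le_power[of 2 k] Bochner_Integration.integral_nonneg) auto
    also have "\<dots> = expectation (\<lambda>\<omega>. (8 * (U \<omega>)\<^sup>2) ^ k)"
    proof -
      have "(4::real) ^ k * 2 ^ k = 8 ^ k" by (simp flip: power_mult_distrib)
      thus ?thesis by (simp add: power_mult power_mult_distrib)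
    qed
    finally show ?thesis by (simp add: power_mult e_def)
  qed simp
qed

end

context indep_finite_moments
begin

definition walk :: "nat \<Rightarrow> 'a \<Rightarrow> real" where
  "walk n \<omega> = (\<Sum>i=1..n. X i \<omega>)"

lemma finite_moment_walk: "finite_moment (2 * m) (walk n)"
  unfolding walk_def[abs_def] by (intro finite_moment_sum fm) auto

lemma walk_Suc: "walk (Suc n) \<omega> = walk n \<omega> + X (Suc n) \<omega>"
  by (simp add: walk_def)

text \<open>The conditional expectation of \<open>\<phi>(S\<^sub>n)\<close> given \<open>S\<^sub>n\<^sub>-\<^sub>1 = s\<close>.\<close>

definition average_step :: "nat \<Rightarrow> (real \<Rightarrow> real) \<Rightarrow> real \<Rightarrow> real" where
  "average_step n \<phi> s = expectation (\<lambda>\<omega>. \<phi> (s + X n \<omega>))"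

lemma integrable_average_step:
  fixes \<phi> :: "real \<Rightarrow> real"
  assumes "1 \<le> n" "L-lipschitz_on UNIV \<phi>"
  shows "integrable M (\<lambda>\<omega>. \<phi> (s + X n \<omega>))"
  by (rule finite_moment_integrable[OF finite_moment_lipschitz[OF
        finite_moment_add[OF finite_moment_const fm[OF assms(1)]] assms(2)]]) (use m in simp)

lemma lipschitz_average_step:
  assumes "1 \<le> n" "L-lipschitz_on UNIV \<phi>"
  shows "L-lipschitz_on UNIV (average_step n \<phi>)"
proof (rule lipschitz_onI)
  fix s t
  have "dist (average_step n \<phi> s) (average_step n \<phi> t) =
      \<bar>expectation (\<lambda>\<omega>. \<phi> (s + X n \<omega>) - \<phi> (t + X n \<omega>))\<bar>"
    using integrable_average_step[OF assms] by (simp add: average_step_def dist_real_def)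
  also have "\<dots> \<le> expectation (\<lambda>\<omega>. \<bar>\<phi> (s + X n \<omega>) - \<phi> (t + X n \<omega>)\<bar>)"
    by (rule integral_abs_bound)
  also have "\<dots> \<le> expectation (\<lambda>\<omega>. L * \<bar>s - t\<bar>)"
  proof (rule integral_mono)
    show "\<bar>\<phi> (s + X n \<omega>) - \<phi> (t + X n \<omega>)\<bar> \<le> L * \<bar>s - t\<bar>" for \<omega>
      using lipschitz_onD[OF assms(2), of "s + X n \<omega>" "t + X n \<omega>"] by (simp add: dist_real_def)
  qed (use integrable_average_step[OF assms] in auto)
  finally show "dist (average_step n \<phi> s) (average_step n \<phi> t) \<le> L * dist s t"
    by (simp add: prob_space dist_real_def)
qed (rule lipschitz_on_nonneg[OF assms(2)])

text \<open>The oscillation caused by one step is dominated by a function of \<open>X\<^sub>n\<close> alone, uniformly in the position.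
It is therefore independent of the past, although the martingale difference that it bounds is not.\<close>

lemma average_step_deviation:
  assumes n: "1 \<le> n" and \<phi>: "L-lipschitz_on UNIV \<phi>"
  shows "\<bar>\<phi> (s + X n \<omega>) - average_step n \<phi> s\<bar> \<le>
    L * (\<bar>centred n \<omega>\<bar> + expectation (\<lambda>\<omega>. \<bar>centred n \<omega>\<bar>))"
proof -
  have L: "L \<ge> 0" by (rule lipschitz_on_nonneg[OF \<phi>])
  have int: "integrable M (centred n)"
    by (rule finite_moment_integrable[OF finite_moment_centred[OF n]]) (use m in simp)
  have "\<phi> (s + X n \<omega>) - average_step n \<phi> s = expectation (\<lambda>\<omega>'. \<phi> (s + X n \<omega>) - \<phi> (s + X n \<omega>'))"
    using integrable_average_step[OF n \<phi>] by (simp add: average_step_def prob_space)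
  also have "\<bar>\<dots>\<bar> \<le> expectation (\<lambda>\<omega>'. \<bar>\<phi> (s + X n \<omega>) - \<phi> (s + X n \<omega>')\<bar>)"
    by (rule integral_abs_bound)
  also have "\<dots> \<le> expectation (\<lambda>\<omega>'. L * (\<bar>centred n \<omega>\<bar> + \<bar>centred n \<omega>'\<bar>))"
  proof (rule integral_mono)
    fix \<omega>'
    have "\<bar>\<phi> (s + X n \<omega>) - \<phi> (s + X n \<omega>')\<bar> \<le> L * \<bar>X n \<omega> - X n \<omega>'\<bar>"
      using lipschitz_onD[OF \<phi>, of "s + X n \<omega>" "s + X n \<omega>'"] by (simp add: dist_real_def)
    also have "\<dots> \<le> L * (\<bar>centred n \<omega>\<bar> + \<bar>centred n \<omega>'\<bar>)"
      using L by (intro mult_left_mono) (auto simp: centred_def)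
    finally show "\<bar>\<phi> (s + X n \<omega>) - \<phi> (s + X n \<omega>')\<bar> \<le> L * (\<bar>centred n \<omega>\<bar> + \<bar>centred n \<omega>'\<bar>)" .
  qed (use integrable_average_step[OF n \<phi>] int in auto)
  also have "\<dots> = L * (\<bar>centred n \<omega>\<bar> + expectation (\<lambda>\<omega>. \<bar>centred n \<omega>\<bar>))"
    using int by (simp add: prob_space)
  finally show ?thesis .
qed

text \<open>The defining property of the conditional expectation: replacing \<open>\<phi>(S\<^sub>n\<^sub>+\<^sub>1)\<close> by its average over the last step does
not change its correlation with functions of the past.\<close>

lemma expectation_increment_orthogonal:
  assumes F: "F \<in> borel_measurable (PiM {1..n} (\<lambda>_. borel))" and \<phi>: "L-lipschitz_on UNIV \<phi>"
    and U: "\<And>\<omega>. U \<omega> = F (restrict (\<lambda>i. X i \<omega>) {1..n})"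
    and int: "integrable M (\<lambda>\<omega>. U \<omega> * \<phi> (walk (Suc n) \<omega>))"
  shows "expectation (\<lambda>\<omega>. U \<omega> * average_step (Suc n) \<phi> (walk n \<omega>)) = expectation (\<lambda>\<omega>. U \<omega> * \<phi> (walk (Suc n) \<omega>))"
proof -
  let ?A = "\<lambda>\<omega>. restrict (\<lambda>i. X i \<omega>) {1..n}" and ?B = "\<lambda>\<omega>. restrict (\<lambda>i. X i \<omega>) {Suc n}"
  let ?h = "\<lambda>(a, b). F a * \<phi> ((\<Sum>i=1..n. a i) + b (Suc n))"
  note F [measurable]
  have [measurable]: "\<phi> \<in> borel_measurable borel"
    by (intro borel_measurable_continuous_onI lipschitz_on_continuous_on[OF \<phi>])
  have ind: "indep_var (PiM {1..n} (\<lambda>_. borel)) ?A (PiM {Suc n} (\<lambda>_. borel)) ?B"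
    by (rule indep_var_restrict[OF indep]) auto
  have h: "?h (?A \<omega>, ?B \<omega>') = U \<omega> * \<phi> (walk n \<omega> + X (Suc n) \<omega>')" for \<omega> \<omega>'
    by (simp add: walk_def U)
  have "expectation (\<lambda>\<omega>. expectation (\<lambda>\<omega>'. ?h (?A \<omega>, ?B \<omega>'))) = expectation (\<lambda>\<omega>. ?h (?A \<omega>, ?B \<omega>))"
  proof (rule expectation_indep_Fubini[OF ind])
    show "?h \<in> borel_measurable (PiM {1..n} (\<lambda>_. borel) \<Otimes>\<^sub>M PiM {Suc n} (\<lambda>_. borel))" by measurable
    show "integrable M (\<lambda>\<omega>. ?h (?A \<omega>, ?B \<omega>))" unfolding h using int by (simp add: walk_Suc)
  qed
  thus ?thesis unfolding h by (simp add: walk_Suc average_step_def)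
qed

text \<open>Induction on \<open>N\<close>. Averaging the last summand \<open>\<phi>\<^sub>N\<^sub>+\<^sub>1(S\<^sub>N\<^sub>+\<^sub>1)\<close> over \<open>X\<^sub>N\<^sub>+\<^sub>1\<close> gives a function \<open>\<psi>(S\<^sub>N)\<close> with the
same Lipschitz constant, which can be absorbed into \<open>\<phi>\<^sub>N\<close>; this leaves a functional of the same kind of the
first \<open>N\<close> variables with unchanged tail sums of Lipschitz constants. The difference \<open>\<Delta>\<close> of the two functionals is a
martingale difference. The sums start at index \<open>0\<close>, where the walk vanishes, so that the induction starts
with a constant.\<close>

lemma lipschitz_functional_moments_le:
  "\<exists>K\<ge>0. \<forall>N \<phi> L. (\<forall>k\<le>N. (L k)-lipschitz_on UNIV (\<phi> k)) \<longrightarrow>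
     moments_le m
       (\<lambda>\<omega>. ((\<Sum>k\<le>N. \<phi> k (walk k \<omega>)) - expectation (\<lambda>\<omega>. \<Sum>k\<le>N. \<phi> k (walk k \<omega>)))\<^sup>2)
       (\<lambda>\<omega>. \<Sum>j=1..N. K * (\<Sum>k=j..N. L k)\<^sup>2 * (centred j \<omega>)\<^sup>2)"
proof -
  obtain \<kappa> where \<kappa>: "\<kappa> \<ge> 0" "\<And>k (x :: real) y. k \<le> m \<Longrightarrow> (x + y) ^ (2 * k) \<le>
     2 * real k * x ^ (2 * k - 1) * y + (x\<^sup>2 + \<kappa> * y\<^sup>2) ^ k"
    using even_power_add_upper[of m] by blast
  define K where "K = 8 * \<kappa>"
  have K: "K \<ge> 0" using \<kappa> by (simp add: K_def)
  have "moments_le m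
       (\<lambda>\<omega>. ((\<Sum>k\<le>N. \<phi> k (walk k \<omega>)) - expectation (\<lambda>\<omega>. \<Sum>k\<le>N. \<phi> k (walk k \<omega>)))\<^sup>2)
       (\<lambda>\<omega>. \<Sum>j=1..N. K * (\<Sum>k=j..N. L k)\<^sup>2 * (centred j \<omega>)\<^sup>2)"
    if "\<forall>k\<le>N. (L k)-lipschitz_on UNIV (\<phi> k)" for N \<phi> L
    using that
  proof (induction N arbitrary: \<phi> L)
    case 0
    show ?case by (simp add: moments_le_def walk_def prob_space)
  next
    case (Suc N)
    define \<psi> where "\<psi> = average_step (Suc N) (\<phi> (Suc N))"
    define \<phi>' where "\<phi>' = \<phi>(N := (\<lambda>s. \<phi> N s + \<psi> s))"
    define L' where "L' = L(N := L N + L (Suc N))"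
    have lip: "(L k)-lipschitz_on UNIV (\<phi> k)" if "k \<le> Suc N" for k using Suc.prems that by blast
    have lip\<psi>: "(L (Suc N))-lipschitz_on UNIV \<psi>"
      unfolding \<psi>_def by (rule lipschitz_average_step) (use lip in auto)
    have lip': "(L' k)-lipschitz_on UNIV (\<phi>' k)" if "k \<le> N" for k
      using lip[of k] lip[of N] that lipschitz_on_add[OF lip[of N] lip\<psi>]
      by (auto simp: L'_def \<phi>'_def)
    define T where "T = (\<lambda>\<omega>. \<Sum>k\<le>Suc N. \<phi> k (walk k \<omega>))"
    define T' where "T' = (\<lambda>\<omega>. \<Sum>k\<le>N. \<phi>' k (walk k \<omega>))"
    define \<Delta> where "\<Delta> = (\<lambda>\<omega>. \<phi> (Suc N) (walk (Suc N) \<omega>) - \<psi> (walk N \<omega>))"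
    define U where "U = (\<lambda>\<omega>. T' \<omega> - expectation T')"
    let ?x = "centred (Suc N)"
    define e where "e = expectation (\<lambda>\<omega>. \<bar>?x \<omega>\<bar>)"
    have T: "T \<omega> = T' \<omega> + \<Delta> \<omega>" for \<omega>
    proof -
      have "T' \<omega> = (\<Sum>k\<le>N. \<phi> k (walk k \<omega>) + (if k = N then \<psi> (walk N \<omega>) else 0))"
        unfolding T'_def \<phi>'_def by (intro sum.cong) auto
      also have "\<dots> = (\<Sum>k\<le>N. \<phi> k (walk k \<omega>)) + \<psi> (walk N \<omega>)"
        by (simp add: sum.distrib)
      finally show ?thesis by (simp add: T_def \<Delta>_def)
    qed
    have sumL: "(\<Sum>k=j..N. L' k) = (\<Sum>k=j..Suc N. L k)" if "j \<le> N" for j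
    proof -
      have "(\<Sum>k=j..N. L' k) = (\<Sum>k=j..N. L k + (if k = N then L (Suc N) else 0))"
        unfolding L'_def by (intro sum.cong) auto
      also have "\<dots> = (\<Sum>k=j..N. L k) + L (Suc N)" using that by (simp add: sum.distrib)
      finally show ?thesis using that by simp
    qed
    have fT': "finite_moment (2 * m) T'"
      unfolding T'_def by (intro finite_moment_sum finite_moment_lipschitz[OF finite_moment_walk lip']) auto
    have fU: "finite_moment (2 * m) U"
      unfolding U_def by (rule finite_moment_diff[OF fT' finite_moment_const])
    have f\<phi>: "finite_moment (2 * m) (\<lambda>\<omega>. \<phi> (Suc N) (walk (Suc N) \<omega>))"
      by (rule finite_moment_lipschitz[OF finite_moment_walk lip]) simp
    have f\<psi>: "finite_moment (2 * m) (\<lambda>\<omega>. \<psi> (walk N \<omega>))"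
      by (rule finite_moment_lipschitz[OF finite_moment_walk lip\<psi>])
    have f\<Delta>: "finite_moment (2 * m) \<Delta>"
      unfolding \<Delta>_def by (rule finite_moment_diff[OF f\<phi> f\<psi>])
    have fx: "finite_moment (2 * m) ?x" by (rule finite_moment_centred) simp
    define G where "G = (\<lambda>a. (\<Sum>k\<le>N. \<phi>' k (\<Sum>i=1..k. a i)) - expectation T')"
    have G: "U \<omega> = G (restrict (\<lambda>i. X i \<omega>) {1..N})" for \<omega>
      unfolding U_def G_def T'_def walk_def by (intro arg_cong2[where f = "(-)"] sum.cong arg_cong[where f = "\<phi>' _"]) auto
    have G_meas [measurable]: "G \<in> borel_measurable (PiM {1..N} (\<lambda>_. borel))"
    proof -
      have [measurable]: "\<phi>' k \<in> borel_measurable borel" if "k \<le> N" for k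
        by (intro borel_measurable_continuous_onI lipschitz_on_continuous_on[OF lip'] that)
      show ?thesis unfolding G_def by measurable
    qed
    \<comment> \<open>\<open>\<Delta>\<close> has conditional mean zero given the first \<open>N\<close> variables\<close>
    have orth: "expectation (\<lambda>\<omega>. U \<omega> ^ i * \<Delta> \<omega>) = 0" if "i < 2 * m" for i
    proof -
      have int: "integrable M (\<lambda>\<omega>. U \<omega> ^ i * \<phi> (Suc N) (walk (Suc N) \<omega>))" "integrable M (\<lambda>\<omega>. U \<omega> ^ i * \<psi> (walk N \<omega>))"
        using finite_moment_integrable_mult[OF fU f\<phi>, of i 1] finite_moment_integrable_mult[OF fU f\<psi>, of i 1] that by simp_all
      have "expectation (\<lambda>\<omega>. U \<omega> ^ i * \<psi> (walk N \<omega>)) = expectation (\<lambda>\<omega>. U \<omega> ^ i * \<phi> (Suc N) (walk (Suc N) \<omega>))"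
        unfolding \<psi>_def
        by (rule expectation_increment_orthogonal[where F = "\<lambda>a. G a ^ i", OF borel_measurable_power[OF G_meas] lip _ int(1)]) (simp_all add: G)
      thus ?thesis using int by (simp add: \<Delta>_def right_diff_distrib)
    qed
    have "expectation T = expectation (\<lambda>\<omega>. T' \<omega> + \<Delta> \<omega>)" unfolding T[symmetric] ..
    also have "\<dots> = expectation T'"
      using orth[of 0] m finite_moment_integrable[OF fT'] finite_moment_integrable[OF f\<Delta>] by simp
    finally have ET: "expectation T = expectation T'" .
    have TU: "T \<omega> - expectation T = U \<omega> + \<Delta> \<omega>" for \<omega> by (simp add: U_def T ET)
    define w where "w = L (Suc N)"
    have V: "\<kappa> * (\<Delta> \<omega>)\<^sup>2 \<le> (\<kappa> * w\<^sup>2) * (\<bar>?x \<omega>\<bar> + e)\<^sup>2" for \<omega>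
    proof -
      have "\<bar>\<Delta> \<omega>\<bar> \<le> w * (\<bar>?x \<omega>\<bar> + e)"
        unfolding \<Delta>_def w_def e_def \<psi>_def walk_Suc by (rule average_step_deviation) (use lip in auto)
      hence "\<bar>\<Delta> \<omega>\<bar>\<^sup>2 \<le> (w * (\<bar>?x \<omega>\<bar> + e))\<^sup>2" by (intro power_mono) auto
      thus ?thesis using \<kappa> by (simp add: power_mult_distrib mult_left_mono mult.assoc)
    qed
    have fV: "finite_moment m (\<lambda>\<omega>. (\<kappa> * w\<^sup>2) * (\<bar>?x \<omega>\<bar> + e)\<^sup>2)"
      by (intro finite_moment_cmult finite_moment_power finite_moment_add finite_moment_abs fx finite_moment_const)
    have fU2: "finite_moment m (\<lambda>\<omega>. (U \<omega>)\<^sup>2)" by (rule finite_moment_power[OF fU])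
    have f\<Delta>2: "finite_moment m (\<lambda>\<omega>. \<kappa> * (\<Delta> \<omega>)\<^sup>2)" by (rule finite_moment_cmult[OF finite_moment_power[OF f\<Delta>]])
    have "moments_le m (\<lambda>\<omega>. (U \<omega> + \<Delta> \<omega>)\<^sup>2) (\<lambda>\<omega>. (U \<omega>)\<^sup>2 + \<kappa> * (\<Delta> \<omega>)\<^sup>2)"
      unfolding moments_le_def
    proof (intro allI impI)
      fix k assume k: "k \<le> m"
      have int1: "integrable M (\<lambda>\<omega>. U \<omega> ^ (2 * k - 1) * \<Delta> \<omega>)"
        using finite_moment_integrable_mult[OF fU f\<Delta>, of "2 * k - 1" 1] k m by simp
      have int2: "integrable M (\<lambda>\<omega>. ((U \<omega>)\<^sup>2 + \<kappa> * (\<Delta> \<omega>)\<^sup>2) ^ k)"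
        by (rule finite_moment_integrable_power[OF finite_moment_add[OF fU2 f\<Delta>2] k])
      have int3: "integrable M (\<lambda>\<omega>. (U \<omega> + \<Delta> \<omega>) ^ (2 * k))"
        by (rule finite_moment_integrable_power[OF finite_moment_add[OF fU f\<Delta>]]) (use k in simp)
      have "expectation (\<lambda>\<omega>. (U \<omega> + \<Delta> \<omega>) ^ (2 * k)) \<le>
          expectation (\<lambda>\<omega>. 2 * real k * (U \<omega> ^ (2 * k - 1) * \<Delta> \<omega>) + ((U \<omega>)\<^sup>2 + \<kappa> * (\<Delta> \<omega>)\<^sup>2) ^ k)"
        using \<kappa>(2)[OF k] int1 int2 int3 by (intro integral_mono) (auto simp: mult.assoc)
      also have "\<dots> = expectation (\<lambda>\<omega>. ((U \<omega>)\<^sup>2 + \<kappa> * (\<Delta> \<omega>)\<^sup>2) ^ k)"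
        using int1 int2 orth[of "2 * k - 1"] k m by simp
      finally show "expectation (\<lambda>\<omega>. ((U \<omega> + \<Delta> \<omega>)\<^sup>2) ^ k) \<le> expectation (\<lambda>\<omega>. ((U \<omega>)\<^sup>2 + \<kappa> * (\<Delta> \<omega>)\<^sup>2) ^ k)"
        by (simp only: power_mult)
    qed
    also have "moments_le m (\<lambda>\<omega>. (U \<omega>)\<^sup>2 + \<kappa> * (\<Delta> \<omega>)\<^sup>2) (\<lambda>\<omega>. (U \<omega>)\<^sup>2 + (\<kappa> * w\<^sup>2) * (\<bar>?x \<omega>\<bar> + e)\<^sup>2)"
    proof (rule moments_le_mono[OF finite_moment_add[OF fU2 fV]])
      show "(\<lambda>\<omega>. (U \<omega>)\<^sup>2 + \<kappa> * (\<Delta> \<omega>)\<^sup>2) \<in> borel_measurable M"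
        by (rule finite_moment_measurable[OF finite_moment_add[OF fU2 f\<Delta>2]])
    qed (use V \<kappa> in auto)
    also have "moments_le m (\<lambda>\<omega>. (U \<omega>)\<^sup>2 + (\<kappa> * w\<^sup>2) * (\<bar>?x \<omega>\<bar> + e)\<^sup>2)
       (\<lambda>\<omega>. (\<Sum>j=1..N. K * (\<Sum>k=j..N. L' k)\<^sup>2 * (centred j \<omega>)\<^sup>2) + (K * w\<^sup>2) * (?x \<omega>)\<^sup>2)"
    proof (rule moments_le_indep_add[OF _ indep_sum_squares fU2 fV finite_moment_sum_squares])
      show "indep_var borel (\<lambda>\<omega>. (U \<omega>)\<^sup>2) borel (\<lambda>\<omega>. (\<kappa> * w\<^sup>2) * (\<bar>?x \<omega>\<bar> + e)\<^sup>2)"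
        unfolding centred_def by (rule indep_var_of_initial_segment[OF indep borel_measurable_power[OF G_meas]]) (auto simp: G)
      show "finite_moment m (\<lambda>\<omega>. (K * w\<^sup>2) * (?x \<omega>)\<^sup>2)"
        by (intro finite_moment_cmult finite_moment_power fx)
      show "moments_le m (\<lambda>\<omega>. (U \<omega>)\<^sup>2) (\<lambda>\<omega>. \<Sum>j=1..N. K * (\<Sum>k=j..N. L' k)\<^sup>2 * (centred j \<omega>)\<^sup>2)"
        using Suc.IH[of L' \<phi>'] lip' unfolding U_def T'_def by blast
      show "moments_le m (\<lambda>\<omega>. (\<kappa> * w\<^sup>2) * (\<bar>?x \<omega>\<bar> + e)\<^sup>2) (\<lambda>\<omega>. (K * w\<^sup>2) * (?x \<omega>)\<^sup>2)"
        using moments_le_cmult[OF moments_le_square_shift_by_absolute_mean[OF fx], of "\<kappa> * w\<^sup>2"] \<kappa>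
        by (simp add: e_def K_def mult_ac)
    qed (use K \<kappa> in \<open>auto intro!: sum_nonneg\<close>)
    finally have "moments_le m (\<lambda>\<omega>. (T \<omega> - expectation T)\<^sup>2)
       (\<lambda>\<omega>. (\<Sum>j=1..N. K * (\<Sum>k=j..N. L' k)\<^sup>2 * (centred j \<omega>)\<^sup>2) + (K * w\<^sup>2) * (?x \<omega>)\<^sup>2)"
      unfolding TU .
    also have "(\<lambda>\<omega>. (\<Sum>j=1..N. K * (\<Sum>k=j..N. L' k)\<^sup>2 * (centred j \<omega>)\<^sup>2) + (K * w\<^sup>2) * (?x \<omega>)\<^sup>2) =
        (\<lambda>\<omega>. \<Sum>j=1..Suc N. K * (\<Sum>k=j..Suc N. L k)\<^sup>2 * (centred j \<omega>)\<^sup>2)"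
      using sumL by (auto simp: w_def intro!: sum.cong)
    finally show ?case unfolding T_def .
  qed
  thus ?thesis using K by blast
qed

end

section \<open>Weighted sums of Lipschitz functions of the normalized walk\<close>

text \<open>Jensen's inequality for the convex function \<open>x\<^sup>n\<close> and weights that need not sum to one.\<close>

lemma weighted_power_mean:
  fixes p z :: "'i \<Rightarrow> real"
  assumes "finite I" and p: "\<And>i. i \<in> I \<Longrightarrow> 0 \<le> p i" and z: "\<And>i. i \<in> I \<Longrightarrow> 0 \<le> z i" and n: "1 \<le> n"
  shows "(\<Sum>i\<in>I. p i * z i) ^ n \<le> (\<Sum>i\<in>I. p i) ^ (n - 1) * (\<Sum>i\<in>I. p i * z i ^ n)"
proof (cases "(\<Sum>i\<in>I. p i) = 0")
  case True
  hence "p i = 0" if "i \<in> I" for i using that p \<open>finite I\<close> by (simp add: sum_nonneg_eq_0_iff)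
  thus ?thesis using n by (simp add: power_0_left)
next
  case False
  define s where "s = (\<Sum>i\<in>I. p i)"
  have s: "s > 0" using False p by (simp add: s_def sum_nonneg order_less_le)
  have conv: "convex_on {0::real..} (\<lambda>x. x ^ n)"
    by (cases "even n") (auto intro: convex_power_odd convex_on_subset[OF convex_power_even])
  have "(\<Sum>i\<in>I. (p i / s) *\<^sub>R z i) ^ n \<le> (\<Sum>i\<in>I. (p i / s) * z i ^ n)"
  proof (rule convex_on_sum[OF \<open>finite I\<close> _ conv])
    show "I \<noteq> {}" using False by auto
    show "(\<Sum>i\<in>I. p i / s) = 1" using s by (simp add: sum_divide_distrib[symmetric] s_def)
  qed (use p z s in auto)
  hence "((\<Sum>i\<in>I. p i * z i) / s) ^ n \<le> (\<Sum>i\<in>I. p i * z i ^ n) / s"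
    by (simp add: sum_divide_distrib)
  hence "(\<Sum>i\<in>I. p i * z i) ^ n \<le> s ^ n / s * (\<Sum>i\<in>I. p i * z i ^ n)"
    using s by (simp add: power_divide field_simps)
  also have "s ^ n / s = s ^ (n - 1)" using s n by (cases n) auto
  finally show ?thesis by (simp add: s_def)
qed

lemma sum_tail_sums:
  fixes v y :: "nat \<Rightarrow> real"
  shows "(\<Sum>j=1..N. (\<Sum>k=j..N. v k) * y j) = (\<Sum>k=1..N. v k * (\<Sum>j=1..k. y j))"
proof (induction N)
  case (Suc N)
  have "(\<Sum>j=1..Suc N. (\<Sum>k=j..Suc N. v k) * y j) = (\<Sum>j=1..N. (\<Sum>k=j..Suc N. v k) * y j) + v (Suc N) * y (Suc N)"
    by simp
  also have "(\<Sum>j=1..N. (\<Sum>k=j..Suc N. v k) * y j) = (\<Sum>j=1..N. (\<Sum>k=j..N. v k) * y j + v (Suc N) * y j)"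
    by (intro sum.cong) (auto simp: algebra_simps)
  finally show ?case using Suc by (simp add: sum.distrib sum_distrib_left algebra_simps)
qed simp

text \<open>Abel summation: a square of a tail sum of \<open>v\<close> is a double sum over pairs, and the variable \<open>y\<^sub>j\<close> occurs in
those pairs both of whose members are at least \<open>j\<close>. Restricting to ordered pairs costs the factor two.\<close>

lemma sum_squared_tail_sums_le:
  fixes v y :: "nat \<Rightarrow> real"
  assumes y: "\<And>j. 0 \<le> y j"
  shows "(\<Sum>j=1..N. (\<Sum>k=j..N. v k)\<^sup>2 * y j) \<le> 2 * (\<Sum>l=1..N. \<Sum>k=1..l. v k * v l * (\<Sum>j=1..k. y j))"
proof (induction N)
  case (Suc N)
  let ?v = "v (Suc N)" and ?Q = "\<lambda>k. \<Sum>j=1..k. y j"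
  have "(\<Sum>j=1..Suc N. (\<Sum>k=j..Suc N. v k)\<^sup>2 * y j) = (\<Sum>j=1..N. (\<Sum>k=j..Suc N. v k)\<^sup>2 * y j) + ?v\<^sup>2 * y (Suc N)"
    by simp
  also have "(\<Sum>j=1..N. (\<Sum>k=j..Suc N. v k)\<^sup>2 * y j) =
      (\<Sum>j=1..N. (\<Sum>k=j..N. v k)\<^sup>2 * y j + 2 * ?v * ((\<Sum>k=j..N. v k) * y j) + ?v\<^sup>2 * y j)"
    by (intro sum.cong) (auto simp: power2_eq_square algebra_simps)
  also have "\<dots> = (\<Sum>j=1..N. (\<Sum>k=j..N. v k)\<^sup>2 * y j) + 2 * ?v * (\<Sum>k=1..N. v k * ?Q k) + ?v\<^sup>2 * ?Q N"
    by (simp only: sum.distrib sum_distrib_left[symmetric] sum_tail_sums)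
  finally have "(\<Sum>j=1..Suc N. (\<Sum>k=j..Suc N. v k)\<^sup>2 * y j) =
     (\<Sum>j=1..N. (\<Sum>k=j..N. v k)\<^sup>2 * y j) + 2 * ?v * (\<Sum>k=1..N. v k * ?Q k) + ?v\<^sup>2 * ?Q (Suc N)"
    by (simp add: algebra_simps)
  also have "\<dots> \<le> 2 * (\<Sum>l=1..N. \<Sum>k=1..l. v k * v l * ?Q k) + 2 * ?v * (\<Sum>k=1..N. v k * ?Q k) + 2 * (?v\<^sup>2 * ?Q (Suc N))"
  proof -
    have "0 \<le> ?v\<^sup>2 * ?Q (Suc N)" using y by (intro mult_nonneg_nonneg sum_nonneg) auto
    with Suc show ?thesis by linarith
  qed
  also have "\<dots> = 2 * (\<Sum>l=1..Suc N. \<Sum>k=1..l. v k * v l * ?Q k)"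
    by (simp add: sum_distrib_left power2_eq_square algebra_simps)
  finally show ?case .
qed simp

locale normalized_walk = indep_finite_moments +
  fixes a b :: "nat \<Rightarrow> real" and C\<^sub>0 :: real
  assumes a_pos: "\<And>n. 1 \<le> n \<Longrightarrow> 0 < a n"
    and moment_bound: "\<And>n. 1 \<le> n \<Longrightarrow> expectation (\<lambda>\<omega>. (walk n \<omega> / a n - b n) ^ (2 * m)) \<le> C\<^sub>0"
begin

definition Y :: "nat \<Rightarrow> 'a \<Rightarrow> real" where
  "Y n \<omega> = walk n \<omega> / a n - b n"

lemma finite_moment_Y: "finite_moment (2 * m) (Y n)"
  using finite_moment_diff[OF finite_moment_cmult[OF finite_moment_walk, of "1 / a n" n] finite_moment_const[of _ "b n"]]
  by (simp add: Y_def[abs_def])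

lemma sum_centred: "(\<Sum>j=1..n. centred j \<omega>) = walk n \<omega> - expectation (walk n)"
proof -
  have "expectation (walk n) = (\<Sum>j=1..n. expectation (X j))"
    unfolding walk_def[abs_def] using m
    by (intro Bochner_Integration.integral_sum finite_moment_integrable[OF fm]) auto
  thus ?thesis by (simp add: centred_def walk_def sum_subtractf)
qed

text \<open>The reverse inequality transfers the assumed moment bound from the normalized sums to the sums of
squares; centring costs only a constant factor, by Jensen's inequality.\<close>

lemma normalized_sum_squares_moment:
  "\<exists>C\<ge>0. \<forall>n\<ge>1. expectation (\<lambda>\<omega>. ((\<Sum>j=1..n. (centred j \<omega>)\<^sup>2) / (a n)\<^sup>2) ^ m) \<le> C"
proof -
  obtain c where c: "c > 0" "\<And>n. moments_le m (\<lambda>\<omega>. \<Sum>j=1..n. c * (centred j \<omega>)\<^sup>2) (\<lambda>\<omega>. (\<Sum>j=1..n. centred j \<omega>)\<^sup>2)"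
    using sum_squares_moments_le_square_sum by blast
  define C where "C = \<bar>(4 ^ m * (2 * C\<^sub>0)) / c ^ m\<bar>"
  have "expectation (\<lambda>\<omega>. ((\<Sum>j=1..n. (centred j \<omega>)\<^sup>2) / (a n)\<^sup>2) ^ m) \<le> C" if n: "1 \<le> n" for n
  proof -
    have an: "a n > 0" using a_pos n by simp
    let ?Q = "\<lambda>\<omega>. \<Sum>j=1..n. (centred j \<omega>)\<^sup>2"
    let ?e = "expectation (Y n)"
    have intY: "integrable M (Y n)" by (rule finite_moment_integrable[OF finite_moment_Y]) (use m in simp)
    have intYm: "integrable M (\<lambda>\<omega>. Y n \<omega> ^ (2 * m))" by (rule finite_moment_integrable_power[OF finite_moment_Y]) simp
    have "walk n \<omega> = a n * Y n \<omega> + a n * b n" for \<omega> using an by (simp add: Y_def field_simps)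
    hence "walk n = (\<lambda>\<omega>. a n * Y n \<omega> + a n * b n)" by (rule ext)
    hence wY: "walk n \<omega> - expectation (walk n) = a n * (Y n \<omega> - ?e)" for \<omega>
      using intY by (simp add: prob_space algebra_simps)
    have "c ^ m * expectation (\<lambda>\<omega>. ?Q \<omega> ^ m) = expectation (\<lambda>\<omega>. (\<Sum>j=1..n. c * (centred j \<omega>)\<^sup>2) ^ m)"
      by (simp add: sum_distrib_left[symmetric] power_mult_distrib)
    also have "\<dots> \<le> expectation (\<lambda>\<omega>. ((\<Sum>j=1..n. centred j \<omega>)\<^sup>2) ^ m)"
      by (rule moments_leD[OF c(2)]) simp
    also have "\<dots> = ((a n)\<^sup>2) ^ m * expectation (\<lambda>\<omega>. (Y n \<omega> - ?e) ^ (2 * m))"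
      unfolding sum_centred wY by (simp add: power_mult_distrib power_mult)
    also have "expectation (\<lambda>\<omega>. (Y n \<omega> - ?e) ^ (2 * m)) \<le> 4 ^ m * (2 * C\<^sub>0)"
    proof -
      have "expectation (\<lambda>\<omega>. (Y n \<omega> - ?e) ^ (2 * m)) \<le> expectation (\<lambda>\<omega>. 4 ^ m * (Y n \<omega> ^ (2 * m) + ?e ^ (2 * m)))"
      proof (rule integral_mono)
        show "integrable M (\<lambda>\<omega>. (Y n \<omega> - ?e) ^ (2 * m))"
          by (rule finite_moment_integrable_power[OF finite_moment_diff[OF finite_moment_Y finite_moment_const]]) simp
        show "(Y n \<omega> - ?e) ^ (2 * m) \<le> 4 ^ m * (Y n \<omega> ^ (2 * m) + ?e ^ (2 * m))" for \<omega>
        proof -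
          have "\<bar>Y n \<omega> - ?e\<bar> ^ (2 * m) \<le> (\<bar>Y n \<omega>\<bar> + \<bar>?e\<bar>) ^ (2 * m)" by (intro power_mono) auto
          also have "\<dots> \<le> 2 ^ (2 * m) * (\<bar>Y n \<omega>\<bar> ^ (2 * m) + \<bar>?e\<bar> ^ (2 * m))" by (rule power_sum_le_two_power) auto
          finally show ?thesis by (simp add: power_even_abs power_mult)
        qed
      qed (use intYm in auto)
      also have "\<dots> = 4 ^ m * (expectation (\<lambda>\<omega>. Y n \<omega> ^ (2 * m)) + ?e ^ (2 * m))"
        using intYm by (simp add: prob_space)
      also have "?e ^ (2 * m) \<le> expectation (\<lambda>\<omega>. Y n \<omega> ^ (2 * m))"
        using m by (intro expectation_power_Jensen finite_moment_Y) auto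
      also have "expectation (\<lambda>\<omega>. Y n \<omega> ^ (2 * m)) \<le> C\<^sub>0" using moment_bound[OF n] by (simp add: Y_def)
      finally show ?thesis by simp
    qed
    finally have "c ^ m * expectation (\<lambda>\<omega>. ?Q \<omega> ^ m) \<le> ((a n)\<^sup>2) ^ m * (4 ^ m * (2 * C\<^sub>0))"
      by (simp add: mult_left_mono)
    hence "expectation (\<lambda>\<omega>. ?Q \<omega> ^ m) / ((a n)\<^sup>2) ^ m \<le> (4 ^ m * (2 * C\<^sub>0)) / c ^ m"
      using c an by (simp add: field_simps)
    also have "\<dots> \<le> C" unfolding C_def by (rule abs_ge_self)
    finally show ?thesis by (simp add: power_divide)
  qed
  moreover have "C \<ge> 0" by (simp add: C_def)
  ultimately show ?thesis by blast
qed

text \<open>The moment of order \<open>2 m\<close> behaves as if the summands \<open>d\<^sub>k f(Y\<^sub>k)\<close> and \<open>d\<^sub>l f(Y\<^sub>l)\<close> had correlation of order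
\<open>a\<^sub>k / a\<^sub>l\<close> for \<open>k \<le> l\<close>. In the proof, the weights \<open>p\<close> are normalized so that each \<open>z\<close>, a sum of squares
divided by \<open>a\<^sub>k\<^sup>2\<close>, has a bounded moment of order \<open>m\<close>.\<close>

theorem weighted_lipschitz_sum_moment:
  assumes f: "L-lipschitz_on UNIV f"
  shows "\<exists>C\<ge>0. \<forall>d N. (\<forall>k\<ge>1. 0 \<le> d k) \<longrightarrow>
    expectation (\<lambda>\<omega>. ((\<Sum>k=1..N. d k * f (Y k \<omega>)) - expectation (\<lambda>\<omega>. \<Sum>k=1..N. d k * f (Y k \<omega>))) ^ (2 * m))
      \<le> C * (\<Sum>l=1..N. \<Sum>k=1..l. d k * d l * (a k / a l)) ^ m"
proof -
  have L: "L \<ge> 0" by (rule lipschitz_on_nonneg[OF f])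
  obtain K where K: "K \<ge> 0" "\<And>N \<phi> L. (\<And>k. k \<le> N \<Longrightarrow> (L k)-lipschitz_on UNIV (\<phi> k)) \<Longrightarrow>
     moments_le m
       (\<lambda>\<omega>. ((\<Sum>k\<le>N. \<phi> k (walk k \<omega>)) - expectation (\<lambda>\<omega>. \<Sum>k\<le>N. \<phi> k (walk k \<omega>)))\<^sup>2)
       (\<lambda>\<omega>. \<Sum>j=1..N. K * (\<Sum>k=j..N. L k)\<^sup>2 * (centred j \<omega>)\<^sup>2)"
    using lipschitz_functional_moments_le by blast
  obtain C where C: "C \<ge> 0" "\<And>n. 1 \<le> n \<Longrightarrow> expectation (\<lambda>\<omega>. ((\<Sum>j=1..n. (centred j \<omega>)\<^sup>2) / (a n)\<^sup>2) ^ m) \<le> C"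
    using normalized_sum_squares_moment by blast
  define C' where "C' = (2 * K * L\<^sup>2) ^ m * C"
  have "expectation (\<lambda>\<omega>. ((\<Sum>k=1..N. d k * f (Y k \<omega>)) - expectation (\<lambda>\<omega>. \<Sum>k=1..N. d k * f (Y k \<omega>))) ^ (2 * m))
      \<le> C' * (\<Sum>l=1..N. \<Sum>k=1..l. d k * d l * (a k / a l)) ^ m"
    if d: "\<forall>k\<ge>1. 0 \<le> d k" for d N
  proof -
    \<comment> \<open>the index \<open>0\<close>, at which nothing is known about \<open>d\<close> and \<open>a\<close>, contributes nothing\<close>
    define \<phi> where "\<phi> k s = (if k = 0 then 0 else d k * f (s / a k - b k))" for k s
    define v where "v k = (if k = 0 then 0 else L * d k / a k)" for k
    have v: "v k \<ge> 0" for k using L d a_pos[of k] by (auto simp: v_def)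
    have lip: "(v k)-lipschitz_on UNIV (\<phi> k)" for k
    proof (rule lipschitz_onI[OF _ v])
      fix s t
      show "dist (\<phi> k s) (\<phi> k t) \<le> v k * dist s t"
      proof (cases "k = 0")
        case False
        have "dist (\<phi> k s) (\<phi> k t) = d k * \<bar>f (s / a k - b k) - f (t / a k - b k)\<bar>"
          using False d by (simp add: \<phi>_def dist_real_def right_diff_distrib[symmetric] abs_mult)
        also have "\<dots> \<le> d k * (L * \<bar>(s - t) / a k\<bar>)"
          using False d lipschitz_onD[OF f, of "s / a k - b k" "t / a k - b k"]
          by (intro mult_left_mono) (auto simp: dist_real_def diff_divide_distrib)
        also have "\<dots> = v k * dist s t" using False a_pos[of k] by (simp add: v_def dist_real_def)
        finally show ?thesis .
      qed (simp add: \<phi>_def v_def)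
    qed
    have eq: "(\<Sum>k\<le>N. \<phi> k (walk k \<omega>)) = (\<Sum>k=1..N. d k * f (Y k \<omega>))" for \<omega>
    proof -
      have "(\<Sum>k\<le>N. \<phi> k (walk k \<omega>)) = (\<Sum>k=1..N. \<phi> k (walk k \<omega>))"
        by (intro sum.mono_neutral_right) (auto simp: \<phi>_def)
      also have "\<dots> = (\<Sum>k=1..N. d k * f (Y k \<omega>))"
        by (intro sum.cong) (auto simp: \<phi>_def Y_def)
      finally show ?thesis .
    qed
    let ?Q = "\<lambda>k \<omega>. \<Sum>j=1..k. (centred j \<omega>)\<^sup>2"
    let ?I = "SIGMA l:{1..N}. {1..l}"
    define p where "p i = v (snd i) * v (fst i) * (a (snd i))\<^sup>2" for i :: "nat \<times> nat"
    define z where "z i \<omega> = ?Q (snd i) \<omega> / (a (snd i))\<^sup>2" for i :: "nat \<times> nat" and \<omega>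
    have Qfm: "finite_moment m (\<lambda>\<omega>. c * ?Q k \<omega>)" for c k
      using finite_moment_sum_squares[of "\<lambda>_. c" k] by (simp add: sum_distrib_left)
    have zfm: "integrable M (\<lambda>\<omega>. z i \<omega> ^ m)" for i
      using finite_moment_integrable_power[OF Qfm[of "1 / (a (snd i))\<^sup>2" "snd i"] order_refl]
      by (simp add: z_def)
    have p0: "p i \<ge> 0" for i using v by (simp add: p_def)
    have z0: "z i \<omega> \<ge> 0" for i \<omega> by (simp add: z_def sum_nonneg)
    have zC: "expectation (\<lambda>\<omega>. z i \<omega> ^ m) \<le> C" if "i \<in> ?I" for i
      unfolding z_def by (rule C(2)) (use that in auto)
    have sum_I: "(\<Sum>i\<in>?I. g (fst i) (snd i)) = (\<Sum>l=1..N. \<Sum>k=1..l. g l k)" for g :: "nat \<Rightarrow> nat \<Rightarrow> real"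
      by (subst sum.Sigma) (auto simp: split_beta)
    have "expectation (\<lambda>\<omega>. ((\<Sum>k=1..N. d k * f (Y k \<omega>)) - expectation (\<lambda>\<omega>. \<Sum>k=1..N. d k * f (Y k \<omega>))) ^ (2 * m))
       \<le> expectation (\<lambda>\<omega>. (\<Sum>j=1..N. K * (\<Sum>k=j..N. v k)\<^sup>2 * (centred j \<omega>)\<^sup>2) ^ m)"
      using moments_leD[OF K(2)[of N v \<phi>, OF lip] order_refl] unfolding eq by (simp only: power_mult)
    also have "\<dots> \<le> expectation (\<lambda>\<omega>. (2 * K) ^ m * ((\<Sum>i\<in>?I. p i) ^ (m - 1) * (\<Sum>i\<in>?I. p i * z i \<omega> ^ m)))"
    proof (rule integral_mono)
      show "integrable M (\<lambda>\<omega>. (\<Sum>j=1..N. K * (\<Sum>k=j..N. v k)\<^sup>2 * (centred j \<omega>)\<^sup>2) ^ m)"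
        by (rule finite_moment_integrable_power[OF finite_moment_sum_squares]) simp
      show "integrable M (\<lambda>\<omega>. (2 * K) ^ m * ((\<Sum>i\<in>?I. p i) ^ (m - 1) * (\<Sum>i\<in>?I. p i * z i \<omega> ^ m)))"
        by (intro integrable_mult_right Bochner_Integration.integrable_sum zfm)
      fix \<omega>
      have "(\<Sum>j=1..N. K * (\<Sum>k=j..N. v k)\<^sup>2 * (centred j \<omega>)\<^sup>2) = K * (\<Sum>j=1..N. (\<Sum>k=j..N. v k)\<^sup>2 * (centred j \<omega>)\<^sup>2)"
        by (simp add: sum_distrib_left mult.assoc)
      also have "\<dots> \<le> K * (2 * (\<Sum>l=1..N. \<Sum>k=1..l. v k * v l * ?Q k \<omega>))"
        by (intro mult_left_mono sum_squared_tail_sums_le v K) auto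
      also have "(\<Sum>l=1..N. \<Sum>k=1..l. v k * v l * ?Q k \<omega>) = (\<Sum>i\<in>?I. p i * z i \<omega>)"
        unfolding p_def z_def sum_I[of "\<lambda>l k. v k * v l * (a k)\<^sup>2 * (?Q k \<omega> / (a k)\<^sup>2)"]
        by (intro sum.cong refl) (auto simp: less_imp_neq[OF a_pos, symmetric])
      finally have "(\<Sum>j=1..N. K * (\<Sum>k=j..N. v k)\<^sup>2 * (centred j \<omega>)\<^sup>2) ^ m \<le> (K * (2 * (\<Sum>i\<in>?I. p i * z i \<omega>))) ^ m"
        using K by (intro power_mono sum_nonneg) auto
      also have "\<dots> = (2 * K) ^ m * (\<Sum>i\<in>?I. p i * z i \<omega>) ^ m"
        by (simp add: power_mult_distrib)
      also have "\<dots> \<le> (2 * K) ^ m * ((\<Sum>i\<in>?I. p i) ^ (m - 1) * (\<Sum>i\<in>?I. p i * z i \<omega> ^ m))"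
        using K m p0 by (intro mult_left_mono weighted_power_mean z0) auto
      finally show "(\<Sum>j=1..N. K * (\<Sum>k=j..N. v k)\<^sup>2 * (centred j \<omega>)\<^sup>2) ^ m \<le> (2 * K) ^ m * ((\<Sum>i\<in>?I. p i) ^ (m - 1) * (\<Sum>i\<in>?I. p i * z i \<omega> ^ m))" .
    qed
    also have "\<dots> = (2 * K) ^ m * ((\<Sum>i\<in>?I. p i) ^ (m - 1) * (\<Sum>i\<in>?I. p i * expectation (\<lambda>\<omega>. z i \<omega> ^ m)))"
      using zfm by simp
    also have "\<dots> \<le> (2 * K) ^ m * ((\<Sum>i\<in>?I. p i) ^ (m - 1) * (\<Sum>i\<in>?I. p i * C))"
      using K p0 zC by (intro mult_left_mono sum_mono zero_le_power sum_nonneg) auto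
    also have "\<dots> = (2 * K) ^ m * C * (\<Sum>i\<in>?I. p i) ^ m"
      using m by (cases m) (simp_all add: sum_distrib_right[symmetric])
    also have "(\<Sum>i\<in>?I. p i) = L\<^sup>2 * (\<Sum>l=1..N. \<Sum>k=1..l. d k * d l * (a k / a l))"
      unfolding p_def sum_I[of "\<lambda>l k. v k * v l * (a k)\<^sup>2"] sum_distrib_left
      by (intro sum.cong refl) (auto simp: v_def power2_eq_square less_imp_neq[OF a_pos, symmetric])
    finally show ?thesis by (simp add: C'_def power_mult_distrib mult_ac)
  qed
  moreover have "C' \<ge> 0" using C K by (simp add: C'_def)
  ultimately show ?thesis by blast
qed

end

section \<open>Growth of the weights\<close>

lemma power_sum_le_powr:
  assumes \<beta>: "0 < \<beta>" "\<beta> \<le> 1"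
  shows "(\<Sum>k=1..l. real k powr (\<beta> - 1)) \<le> real l powr \<beta> / \<beta>"
proof (induction l)
  case (Suc l)
  show ?case
  proof (cases "l = 0")
    case False
    have "\<exists>z::real. real l < z \<and> z < real (Suc l) \<and>
        real (Suc l) powr \<beta> - real l powr \<beta> = (real (Suc l) - real l) * (\<beta> * z powr (\<beta> - 1))"
      using False by (intro MVT2) (auto intro!: derivative_eq_intros)
    then obtain z where z: "real l < z" "z < real (Suc l)" "real (Suc l) powr \<beta> - real l powr \<beta> = \<beta> * z powr (\<beta> - 1)"
      by auto
    have "real (Suc l) powr (\<beta> - 1) \<le> z powr (\<beta> - 1)"
      using z \<beta> by (intro powr_mono2') auto
    hence "real (Suc l) powr (\<beta> - 1) \<le> (real (Suc l) powr \<beta> - real l powr \<beta>) / \<beta>"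
      using z \<beta> by simp
    with Suc show ?thesis by (simp add: diff_divide_distrib)
  qed (use \<beta> in simp)
qed (use \<beta> in simp)

text \<open>Shifting the argument of the logarithm by \<open>exp \<rho>\<close> makes \<open>x / (ln x)\<^sup>\<rho>\<close> monotone on the whole positive axis:
the shifted logarithm exceeds \<open>\<rho>\<close>, which makes the logarithmic derivative nonnegative.\<close>

lemma div_ln_powr_mono:
  fixes x y :: real
  assumes "0 < x" "x \<le> y" and \<rho>: "0 < \<rho>"
  shows "x / ln (x + exp \<rho>) powr \<rho> \<le> y / ln (y + exp \<rho>) powr \<rho>"
proof -
  define g where "g x = ln x - \<rho> * ln (ln (x + exp \<rho>))" for x :: real
  have ln_gt: "ln (x + exp \<rho>) > \<rho>" if "x > 0" for x
    using that ln_less_cancel_iff[of "exp \<rho>" "x + exp \<rho>"] by (simp add: add_pos_pos)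
  have exp_g: "exp (g x) = x / ln (x + exp \<rho>) powr \<rho>" if "x > 0" for x
    using that ln_gt[OF that] \<rho> by (simp add: g_def exp_diff powr_def)
  have "g x \<le> g y"
  proof (rule DERIV_nonneg_imp_nondecreasing[OF \<open>x \<le> y\<close>])
    fix t assume "x \<le> t" "t \<le> y"
    hence t: "t > 0" using assms by simp
    have e: "t + exp \<rho> > 1" using t one_less_exp_iff[of \<rho>] \<rho> by linarith
    have "(g has_real_derivative 1 / t - \<rho> * ((1 / (t + exp \<rho>)) / ln (t + exp \<rho>))) (at t)"
      unfolding g_def using t e ln_gt[OF t] \<rho> by (auto intro!: derivative_eq_intros)
    moreover have "\<rho> * ((1 / (t + exp \<rho>)) / ln (t + exp \<rho>)) \<le> 1 / t"
    proof -
      have "\<rho> * t \<le> ln (t + exp \<rho>) * (t + exp \<rho>)"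
        using t ln_gt[OF t] \<rho> by (intro mult_mono) auto
      moreover have "\<rho> * ((1 / E) / l) \<le> 1 / t" if "\<rho> * t \<le> l * E" "E > 0" "l > 0" for E l
        using that t by (simp add: field_simps)
      ultimately show ?thesis using e ln_gt[OF t] \<rho> by simp
    qed
    ultimately show "\<exists>z. (g has_real_derivative z) (at t) \<and> 0 \<le> z" by fastforce
  qed
  hence "exp (g x) \<le> exp (g y)" by simp
  thus ?thesis using exp_g[of x] exp_g[of y] assms by simp
qed

lemma eventually_bound_imp_uniform_bound:
  fixes u v :: "nat \<Rightarrow> real"
  assumes ev: "\<forall>\<^sub>F k in sequentially. u k \<le> C * v k" and v: "\<And>k. 1 \<le> k \<Longrightarrow> 0 < v k"
  shows "\<exists>C'>0. \<forall>k\<ge>1. u k \<le> C' * v k"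
proof -
  obtain K where K: "\<And>k. k \<ge> K \<Longrightarrow> u k \<le> C * v k"
    using ev by (auto simp: eventually_sequentially)
  define C' where "C' = \<bar>C\<bar> + (\<Sum>k=1..K. \<bar>u k / v k\<bar>) + 1"
  have S: "(\<Sum>k=1..K. \<bar>u k / v k\<bar>) \<ge> 0" by (rule sum_nonneg) simp
  have "u k \<le> C' * v k" if k: "k \<ge> 1" for k
  proof (cases "k \<le> K")
    case True
    have "\<bar>u k / v k\<bar> \<le> (\<Sum>k=1..K. \<bar>u k / v k\<bar>)"
      using True k by (intro member_le_sum) auto
    hence "u k / v k \<le> C'" unfolding C'_def by linarith
    thus ?thesis using v[OF k] by (simp add: field_simps)
  next
    case False
    have "u k \<le> C * v k" using K False by simp
    also have "\<dots> \<le> C' * v k" using v[OF k] S by (intro mult_right_mono) (auto simp: C'_def)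
    finally show ?thesis .
  qed
  thus ?thesis using S by (intro exI[of _ C']) (auto simp: C'_def)
qed

lemma weight_sum_Suc: "weight_sum d (Suc n) = weight_sum d n + d (Suc n)"
  by (simp add: weight_sum_def)

lemma weight_sum_mono:
  assumes "\<And>k. k \<ge> 1 \<Longrightarrow> d k > 0" "m \<le> n"
  shows "weight_sum d m \<le> weight_sum d n"
  unfolding weight_sum_def using assms by (intro sum_mono2) (auto simp: less_imp_le)

lemma weight_sum_pos:
  assumes "\<And>k. k \<ge> 1 \<Longrightarrow> d k > 0" "n \<ge> 1"
  shows "weight_sum d n > 0"
  unfolding weight_sum_def using assms by (intro sum_pos) auto

text \<open>The weights are eventually bounded below by a multiple of the harmonic series.\<close>

lemma weight_sum_at_top:
  assumes d: "\<And>k. k \<ge> 1 \<Longrightarrow> d k > 0" and lim: "liminf (\<lambda>k. ereal (real k * d k)) > 0"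
  shows "filterlim (weight_sum d) at_top sequentially"
proof (rule ccontr)
  assume "\<not> filterlim (weight_sum d) at_top sequentially"
  then obtain Z where Z: "\<not> (\<forall>\<^sub>F n in sequentially. Z \<le> weight_sum d n)"
    by (auto simp: filterlim_at_top)
  have bdd: "weight_sum d n \<le> Z" for n
  proof (rule ccontr)
    assume "\<not> weight_sum d n \<le> Z"
    hence "\<forall>k\<ge>n. Z \<le> weight_sum d k" using weight_sum_mono[of d n] d by (meson less_imp_le not_le order_trans)
    thus False using Z by (auto simp: eventually_sequentially)
  qed
  have "summable (\<lambda>k. d (Suc k))"
  proof (rule summableI_nonneg_bounded)
    show "(\<Sum>k<n. d (Suc k)) \<le> Z" for n
      using bdd[of n] by (simp add: weight_sum_def sum.shift_bounds_Suc_ivl[symmetric] lessThan_atLeast0 atLeastLessThanSuc_atLeastAtMost)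
  qed (use d in \<open>auto simp: less_imp_le\<close>)
  hence sd: "summable d" by (simp only: summable_Suc_iff)
  obtain c' where c': "0 < ereal c'" "ereal c' < liminf (\<lambda>k. ereal (real k * d k))"
    using ereal_dense2[OF lim] by auto
  have "\<forall>\<^sub>F k in sequentially. ereal c' < ereal (real k * d k)"
    using less_LiminfD[OF c'(2)] .
  hence "\<forall>\<^sub>F k in sequentially. norm (c' * inverse (real k)) \<le> d k"
    using eventually_gt_at_top[of 0]
  proof eventually_elim
    case (elim k)
    thus ?case using c' by (simp add: field_simps)
  qed
  from summable_comparison_test_ev[OF this sd] have "summable (\<lambda>k. inverse (real k))"
    using c' by (simp add: summable_cmult_iff)
  thus False using not_summable_harmonic[where 'a = real] by simp
qed

text \<open>The growth condition on the weights with the shifted logarithm, valid at every positive index and not only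
asymptotically.\<close>

locale log_weights =
  fixes d :: "nat \<Rightarrow> real" and \<rho> :: real and C\<^sub>1 :: real
  assumes d_pos: "\<And>k. k \<ge> 1 \<Longrightarrow> d k > 0" and \<rho>_pos: "0 < \<rho>" and C1_pos: "0 < C\<^sub>1"
    and D_at_top: "filterlim (weight_sum d) at_top sequentially"
    and d_le: "\<And>k. k \<ge> 1 \<Longrightarrow> d k \<le> C\<^sub>1 * (weight_sum d k / (real k * ln (weight_sum d k + exp \<rho>) powr \<rho>))"

text \<open>For large arguments the shift at most doubles the logarithm, and finitely many indices only affect the
constant.\<close>

lemma log_weightsI:
  assumes d: "\<And>k. k \<ge> 1 \<Longrightarrow> d k > 0" and \<rho>: "0 < \<rho>"
    and top: "filterlim (weight_sum d) at_top sequentially"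
    and bigo: "d \<in> O(\<lambda>k. weight_sum d k / (real k * ln (weight_sum d k) powr \<rho>))"
  shows "\<exists>C. log_weights d \<rho> C"
proof -
  let ?D = "weight_sum d"
  from bigo obtain c where c: "c > 0" "\<forall>\<^sub>F k in sequentially. norm (d k) \<le> c * norm (?D k / (real k * ln (?D k) powr \<rho>))"
    by (auto elim: landau_o.bigE)
  have "\<forall>\<^sub>F k in sequentially. ?D k \<ge> exp \<rho> + 2" using top by (simp add: filterlim_at_top)
  with c(2) eventually_gt_at_top[of 0]
  have ev: "\<forall>\<^sub>F k in sequentially. d k \<le> (c * 2 powr \<rho>) * (?D k / (real k * ln (?D k + exp \<rho>) powr \<rho>))"
  proof eventually_elim
    case (elim k)
    have D: "?D k \<ge> exp \<rho>" "?D k \<ge> 2" using elim by (auto intro: order_trans[rotated])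
    have "?D k + exp \<rho> \<le> 2 * ?D k" using D by simp
    also have "\<dots> \<le> ?D k ^ 2" using D by (simp add: power2_eq_square)
    finally have "ln (?D k + exp \<rho>) \<le> ln (?D k ^ 2)" using D by (subst ln_le_cancel_iff) (auto simp: add_pos_pos)
    also have "\<dots> = 2 * ln (?D k)" using D by (simp add: ln_realpow)
    finally have le: "ln (?D k + exp \<rho>) \<le> 2 * ln (?D k)" .
    have "?D k + exp \<rho> > 1" using D exp_gt_zero[of \<rho>] by linarith
    hence pos: "ln (?D k + exp \<rho>) > 0" "ln (?D k) > 0" using D by (auto intro!: ln_gt_zero)
    have le': "ln (?D k + exp \<rho>) powr \<rho> \<le> 2 powr \<rho> * ln (?D k) powr \<rho>"
      using powr_mono2[OF _ _ le, of \<rho>] pos \<rho> by (simp add: powr_mult)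
    have "d k \<le> c * (?D k / (real k * ln (?D k) powr \<rho>))"
      using elim d[of k] D by simp
    also have "\<dots> \<le> c * (?D k / (real k * (ln (?D k + exp \<rho>) powr \<rho> / 2 powr \<rho>)))"
      using elim c D pos le' by (intro mult_left_mono divide_left_mono mult_left_mono mult_pos_pos) (auto simp: field_simps)
    finally show ?case by (simp add: field_simps)
  qed
  have "0 < ?D k / (real k * ln (?D k + exp \<rho>) powr \<rho>)" if "k \<ge> 1" for k
  proof -
    have "?D k > 0" using weight_sum_pos[OF d that] .
    moreover have "?D k + exp \<rho> > 1" using one_less_exp_iff[of \<rho>] \<rho> calculation by linarith
    hence "ln (?D k + exp \<rho>) > 0" by (rule ln_gt_zero)
    ultimately show ?thesis using that by (intro divide_pos_pos mult_pos_pos) auto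
  qed
  from eventually_bound_imp_uniform_bound[OF ev this]
  obtain C where C: "C > 0" "\<And>k. k \<ge> 1 \<Longrightarrow> d k \<le> C * (?D k / (real k * ln (?D k + exp \<rho>) powr \<rho>))"
    by blast
  show ?thesis by (rule exI[of _ C]) (unfold_locales; use C d \<rho> top in auto)
qed

context log_weights
begin

abbreviation D :: "nat \<Rightarrow> real" where "D \<equiv> weight_sum d"

definition lnD :: "nat \<Rightarrow> real" where "lnD n = ln (D n + exp \<rho>)"

lemma D_nonneg: "0 \<le> D n"
  unfolding weight_sum_def using d_pos by (intro sum_nonneg) (auto simp: less_imp_le)

lemma lnD_ge: "\<rho> \<le> lnD n"
  unfolding lnD_def using ln_le_cancel_iff[of "exp \<rho>" "D n + exp \<rho>"] D_nonneg[of n] by (simp add: add_nonneg_pos)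

lemma lnD_pos: "0 < lnD n"
  using lnD_ge \<rho>_pos by (rule less_le_trans[rotated])

lemma d_div_D_tendsto_0: "(\<lambda>k. d k / D k) \<longlonglongrightarrow> 0"
proof (rule tendsto_sandwich)
  show "\<forall>\<^sub>F k in sequentially. 0 \<le> d k / D k"
    using eventually_ge_at_top[of 1] by eventually_elim (use d_pos D_nonneg in \<open>auto simp: less_imp_le\<close>)
  show "\<forall>\<^sub>F k in sequentially. d k / D k \<le> (C\<^sub>1 / \<rho> powr \<rho>) * inverse (real k)"
    using eventually_ge_at_top[of 1]
  proof eventually_elim
    case (elim k)
    have "d k \<le> C\<^sub>1 * (D k / (real k * lnD k powr \<rho>))" using d_le[OF elim] by (simp add: lnD_def)
    also have "\<dots> \<le> C\<^sub>1 * (D k / (real k * \<rho> powr \<rho>))"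
      using elim C1_pos D_nonneg lnD_pos[of k] lnD_ge \<rho>_pos
      by (intro mult_left_mono divide_left_mono powr_mono2 mult_pos_pos) auto
    finally show ?case using weight_sum_pos[OF d_pos elim] elim \<rho>_pos by (simp add: field_simps)
  qed
  show "(\<lambda>k. (C\<^sub>1 / \<rho> powr \<rho>) * inverse (real k)) \<longlonglongrightarrow> 0"
    by (rule tendsto_mult_right_zero[OF lim_inverse_n])
qed simp

text \<open>Bounding \<open>d\<^sub>k\<close> by \<open>\<Phi>\<^sub>l / k\<close> for \<open>k \<le> l\<close>, with \<open>\<Phi>\<close> increasing, leaves in the inner sum the power sum
\<open>\<Sum>\<^sub>k\<^sub>\<le>\<^sub>l k\<^bsup>\<gamma> - 1\<^esup>\<close>, which is of order \<open>l\<^sup>\<gamma>\<close> and cancels the denominator. The exponent may be lowered to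
at most one since \<open>k / l \<le> 1\<close>.\<close>

lemma weighted_correlation_sum_le:
  assumes "0 < \<beta>"
  shows "\<exists>C\<ge>0. \<forall>N\<ge>1. (\<Sum>l=1..N. \<Sum>k=1..l. d k * d l * (real k / real l) powr \<beta>) \<le> C * ((D N)\<^sup>2 / lnD N powr \<rho>)"
proof -
  define \<gamma> where "\<gamma> = min \<beta> 1"
  have \<gamma>: "0 < \<gamma>" "\<gamma> \<le> 1" "\<gamma> \<le> \<beta>" using assms by (auto simp: \<gamma>_def)
  define \<Phi> where "\<Phi> n = D n / lnD n powr \<rho>" for n
  have \<Phi>_nonneg: "0 \<le> \<Phi> n" for n using D_nonneg by (simp add: \<Phi>_def)
  have \<Phi>_mono: "\<Phi> k \<le> \<Phi> l" if "1 \<le> k" "k \<le> l" for k l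
    unfolding \<Phi>_def lnD_def using that
    by (intro div_ln_powr_mono weight_sum_pos weight_sum_mono d_pos \<rho>_pos) auto
  have inner: "(\<Sum>k=1..l. d k * (real k / real l) powr \<beta>) \<le> C\<^sub>1 / \<gamma> * \<Phi> l" if l: "l \<ge> 1" for l
  proof -
    have "d k * (real k / real l) powr \<beta> \<le> C\<^sub>1 * \<Phi> l * real l powr (- \<gamma>) * real k powr (\<gamma> - 1)" if k: "k \<in> {1..l}" for k
    proof -
      have "(real k / real l) powr \<beta> \<le> (real k / real l) powr \<gamma>"
        using k \<gamma> by (intro powr_mono') auto
      moreover have "d k \<le> C\<^sub>1 * (\<Phi> l / real k)"
      proof -
        have "d k \<le> C\<^sub>1 * (\<Phi> k / real k)" using d_le[of k] k by (simp add: \<Phi>_def lnD_def mult_ac)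
        also have "\<dots> \<le> C\<^sub>1 * (\<Phi> l / real k)"
          using k C1_pos by (intro mult_left_mono divide_right_mono \<Phi>_mono) auto
        finally show ?thesis .
      qed
      ultimately have "d k * (real k / real l) powr \<beta> \<le> C\<^sub>1 * (\<Phi> l / real k) * (real k / real l) powr \<gamma>"
        using d_pos[of k] k by (intro mult_mono) auto
      also have "\<dots> = C\<^sub>1 * \<Phi> l * real l powr (- \<gamma>) * real k powr (\<gamma> - 1)"
        using k l by (simp add: powr_divide powr_diff powr_minus field_simps)
      finally show ?thesis .
    qed
    hence "(\<Sum>k=1..l. d k * (real k / real l) powr \<beta>) \<le> (\<Sum>k=1..l. C\<^sub>1 * \<Phi> l * real l powr (- \<gamma>) * real k powr (\<gamma> - 1))"
      by (rule sum_mono)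
    also have "\<dots> = C\<^sub>1 * \<Phi> l * real l powr (- \<gamma>) * (\<Sum>k=1..l. real k powr (\<gamma> - 1))"
      by (simp add: sum_distrib_left)
    also have "\<dots> \<le> C\<^sub>1 * \<Phi> l * real l powr (- \<gamma>) * (real l powr \<gamma> / \<gamma>)"
      using C1_pos \<Phi>_nonneg by (intro mult_left_mono power_sum_le_powr \<gamma>) auto
    also have "\<dots> = C\<^sub>1 / \<gamma> * \<Phi> l" using l by (simp add: powr_minus field_simps)
    finally show ?thesis .
  qed
  have "(\<Sum>l=1..N. \<Sum>k=1..l. d k * d l * (real k / real l) powr \<beta>) \<le> C\<^sub>1 / \<gamma> * ((D N)\<^sup>2 / lnD N powr \<rho>)" if N: "N \<ge> 1" for N
  proof -
    have "(\<Sum>l=1..N. \<Sum>k=1..l. d k * d l * (real k / real l) powr \<beta>) = (\<Sum>l=1..N. d l * (\<Sum>k=1..l. d k * (real k / real l) powr \<beta>))"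
      by (simp add: sum_distrib_left mult_ac)
    also have "\<dots> \<le> (\<Sum>l=1..N. d l * (C\<^sub>1 / \<gamma> * \<Phi> N))"
    proof (intro sum_mono mult_left_mono)
      fix l assume l: "l \<in> {1..N}"
      have "(\<Sum>k=1..l. d k * (real k / real l) powr \<beta>) \<le> C\<^sub>1 / \<gamma> * \<Phi> l" using inner l by simp
      also have "\<dots> \<le> C\<^sub>1 / \<gamma> * \<Phi> N" using l \<gamma> C1_pos by (intro mult_left_mono \<Phi>_mono) auto
      finally show "(\<Sum>k=1..l. d k * (real k / real l) powr \<beta>) \<le> C\<^sub>1 / \<gamma> * \<Phi> N" .
      show "0 \<le> d l" using d_pos[of l] l by simp
    qed
    also have "\<dots> = C\<^sub>1 / \<gamma> * (D N * \<Phi> N)"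
      unfolding sum_distrib_right[symmetric] weight_sum_def by simp
    also have "D N * \<Phi> N = (D N)\<^sup>2 / lnD N powr \<rho>" by (simp add: \<Phi>_def power2_eq_square)
    finally show ?thesis .
  qed
  moreover have "C\<^sub>1 / \<gamma> \<ge> 0" using C1_pos \<gamma> by simp
  ultimately show ?thesis by blast
qed

end

section \<open>Weak convergence and bounded second moments\<close>

definition truncate :: "real \<Rightarrow> real \<Rightarrow> real" where
  "truncate K x = max (- K) (min K x)"

lemma truncate_error: "0 < K \<Longrightarrow> \<bar>x - truncate K x\<bar> \<le> x\<^sup>2 / K"
proof -
  assume K: "0 < K"
  have *: "\<bar>x\<bar> - K \<le> x\<^sup>2 / K"
  proof -
    have "\<bar>x\<bar> * K \<le> x\<^sup>2 + K * K"
      using sum_squares_bound[of "\<bar>x\<bar>" K] mult_nonneg_nonneg[OF abs_ge_zero[of x] less_imp_le[OF K]]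
      unfolding power2_abs power2_eq_square[of K] by linarith
    thus ?thesis using K by (simp add: field_simps)
  qed
  show ?thesis using * K by (auto simp: truncate_def max_def min_def)
qed

lemma (in prob_space) truncated_mean_error:
  fixes g :: "'a \<Rightarrow> real"
  assumes [measurable]: "g \<in> borel_measurable M" and int2: "integrable M (\<lambda>x. (g x)\<^sup>2)"
    and B: "expectation (\<lambda>x. (g x)\<^sup>2) \<le> B" and K: "0 < K"
  shows "integrable M g" and "\<bar>expectation g - expectation (\<lambda>x. truncate K (g x))\<bar> \<le> B / K"
proof -
  have le: "AE x in M. norm (g x) \<le> norm (1 + (g x)\<^sup>2)"
  proof (rule AE_I2)
    show "norm (g x) \<le> norm (1 + (g x)\<^sup>2)" for x
      using sum_squares_bound[of "\<bar>g x\<bar>" 1] by simp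
  qed
  have int1: "integrable M (\<lambda>x. 1 + (g x)\<^sup>2)" using int2 by simp
  show int: "integrable M g" by (rule Bochner_Integration.integrable_bound[OF int1 _ le]) simp
  have intt: "integrable M (\<lambda>x. truncate K (g x))"
    using K by (intro integrable_const_bound[of _ K]) (auto simp: truncate_def)
  have "\<bar>expectation g - expectation (\<lambda>x. truncate K (g x))\<bar> = \<bar>expectation (\<lambda>x. g x - truncate K (g x))\<bar>"
    using int intt by simp
  also have "\<dots> \<le> expectation (\<lambda>x. \<bar>g x - truncate K (g x)\<bar>)" by (rule integral_abs_bound)
  also have "\<dots> \<le> expectation (\<lambda>x. (g x)\<^sup>2 / K)"
    using int intt int2 truncate_error[OF K] by (intro integral_mono) auto
  also have "\<dots> \<le> B / K" using B K by (simp add: divide_right_mono)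
  finally show "\<bar>expectation g - expectation (\<lambda>x. truncate K (g x))\<bar> \<le> B / K" .
qed

text \<open>Truncation at height \<open>K\<close> costs at most \<open>B / K\<close>, uniformly for all measures of the sequence and, once the
second moment of the limit is known to be bounded as well, also for the limit. That bound is obtained
from the bounded continuous functions \<open>min (g\<^sup>2) K\<close> by monotone convergence.\<close>

lemma weak_conv_bounded_second_moment:
  fixes \<mu> :: "nat \<Rightarrow> real measure" and P :: "real measure" and g :: "real \<Rightarrow> real"
  assumes \<mu>: "\<And>n. real_distribution (\<mu> n)" and P: "real_distribution P" and conv: "weak_conv_m \<mu> P"
    and g: "\<And>x. isCont g x"
    and int: "\<And>n. n \<ge> 1 \<Longrightarrow> integrable (\<mu> n) (\<lambda>x. (g x)\<^sup>2)"
    and B: "\<And>n. n \<ge> 1 \<Longrightarrow> (\<integral>x. (g x)\<^sup>2 \<partial>\<mu> n) \<le> B"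
  shows "integrable P g" and "(\<lambda>n. \<integral>x. g x \<partial>\<mu> n) \<longlonglongrightarrow> (\<integral>x. g x \<partial>P)"
proof -
  interpret P: real_distribution P by (rule P)
  have g_meas: "g \<in> borel_measurable borel"
    by (intro borel_measurable_continuous_onI continuous_at_imp_continuous_on) (auto simp: g)
  have [measurable]: "g \<in> borel_measurable P" using g_meas by simp
  have conv_bdd: "(\<lambda>n. \<integral>x. h x \<partial>\<mu> n) \<longlonglongrightarrow> (\<integral>x. h x \<partial>P)"
    if "\<And>x. isCont h x" "\<And>x. \<bar>h x\<bar> \<le> K" for h :: "real \<Rightarrow> real" and K
    using weak_conv_imp_integral_bdd_continuous_conv[OF \<mu> P conv, of h K] that by simp
  have trunc: "(\<integral>x. min ((g x)\<^sup>2) (real K) \<partial>P) \<le> B" for K :: nat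
  proof (rule LIMSEQ_le_const2[OF conv_bdd])
    show "isCont (\<lambda>x. min ((g x)\<^sup>2) (real K)) x" for x using g by (intro continuous_intros)
    show "\<bar>min ((g x)\<^sup>2) (real K)\<bar> \<le> real K" for x by auto
    show "\<exists>N. \<forall>n\<ge>N. (\<integral>x. min ((g x)\<^sup>2) (real K) \<partial>\<mu> n) \<le> B"
    proof (intro exI[of _ 1] allI impI)
      fix n :: nat assume n: "1 \<le> n"
      interpret Q: real_distribution "\<mu> n" by (rule \<mu>)
      have [measurable]: "g \<in> borel_measurable (\<mu> n)" using g_meas by simp
      have "(\<integral>x. min ((g x)\<^sup>2) (real K) \<partial>\<mu> n) \<le> (\<integral>x. (g x)\<^sup>2 \<partial>\<mu> n)"
        by (intro integral_mono int n Q.integrable_const_bound[of _ "real K"]) auto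
      also have "\<dots> \<le> B" by (rule B[OF n])
      finally show "(\<integral>x. min ((g x)\<^sup>2) (real K) \<partial>\<mu> n) \<le> B" .
    qed
  qed
  have "(\<integral>\<^sup>+x. ennreal ((g x)\<^sup>2) \<partial>P) \<le> ennreal B"
  proof -
    have sup: "(SUP K. ennreal (min y (real K))) = ennreal y" for y
    proof (rule antisym)
      show "(SUP K. ennreal (min y (real K))) \<le> ennreal y" by (intro SUP_least ennreal_leI) simp
      obtain K :: nat where "y \<le> real K" using real_arch_simple by blast
      thus "ennreal y \<le> (SUP K. ennreal (min y (real K)))" by (intro SUP_upper2[of K]) auto
    qed
    have "(\<integral>\<^sup>+x. ennreal ((g x)\<^sup>2) \<partial>P) = (\<integral>\<^sup>+x. (SUP K. ennreal (min ((g x)\<^sup>2) (real K))) \<partial>P)"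
      by (simp add: sup)
    also have "\<dots> = (SUP K. \<integral>\<^sup>+x. ennreal (min ((g x)\<^sup>2) (real K)) \<partial>P)"
      by (intro nn_integral_monotone_convergence_SUP) (auto simp: incseq_def le_fun_def intro!: ennreal_leI)
    also have "\<dots> \<le> ennreal B"
    proof (rule SUP_least)
      fix K :: nat
      have "integrable P (\<lambda>x. min ((g x)\<^sup>2) (real K))"
        by (intro P.integrable_const_bound[of _ "real K"]) auto
      hence "(\<integral>\<^sup>+x. ennreal (min ((g x)\<^sup>2) (real K)) \<partial>P) = ennreal (\<integral>x. min ((g x)\<^sup>2) (real K) \<partial>P)"
        by (intro nn_integral_eq_integral) auto
      also have "\<dots> \<le> ennreal B" by (intro ennreal_leI trunc)
      finally show "(\<integral>\<^sup>+x. ennreal (min ((g x)\<^sup>2) (real K)) \<partial>P) \<le> ennreal B" .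
    qed
    finally show ?thesis .
  qed
  hence int2P: "integrable P (\<lambda>x. (g x)\<^sup>2)"
    by (intro integrableI_bounded) (auto simp: top_unique less_top[symmetric] le_less_trans[OF _ ennreal_less_top])
  have B0: "0 \<le> B" using trunc[of 0] by (auto intro: order_trans[rotated])
  have BP: "(\<integral>x. (g x)\<^sup>2 \<partial>P) \<le> B"
    using \<open>(\<integral>\<^sup>+x. ennreal ((g x)\<^sup>2) \<partial>P) \<le> ennreal B\<close> B0
    by (subst (asm) nn_integral_eq_integral[OF int2P]) auto
  show "integrable P g" by (rule P.truncated_mean_error(1)[OF _ int2P BP, of 1]) auto
  show "(\<lambda>n. \<integral>x. g x \<partial>\<mu> n) \<longlonglongrightarrow> (\<integral>x. g x \<partial>P)"
  proof (rule LIMSEQ_I)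
    fix \<epsilon> :: real assume \<epsilon>: "0 < \<epsilon>"
    define K where "K = 3 * B / \<epsilon> + 1"
    have K: "K > 0" using B0 \<epsilon> by (simp add: K_def add_nonneg_pos)
    have BK: "B / K < \<epsilon> / 3" using B0 \<epsilon> K by (simp add: K_def field_simps)
    have "(\<lambda>n. \<integral>x. truncate K (g x) \<partial>\<mu> n) \<longlonglongrightarrow> (\<integral>x. truncate K (g x) \<partial>P)"
    proof (rule conv_bdd)
      show "isCont (\<lambda>x. truncate K (g x)) x" for x
        unfolding truncate_def using g by (intro continuous_intros)
      show "\<bar>truncate K (g x)\<bar> \<le> K" for x using K by (auto simp: truncate_def)
    qed
    from LIMSEQ_D[OF this, of "\<epsilon> / 3"] \<epsilon> obtain N where
      N: "\<And>n. n \<ge> N \<Longrightarrow> \<bar>(\<integral>x. truncate K (g x) \<partial>\<mu> n) - (\<integral>x. truncate K (g x) \<partial>P)\<bar> < \<epsilon> / 3" by auto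
    have "\<bar>(\<integral>x. g x \<partial>\<mu> n) - (\<integral>x. g x \<partial>P)\<bar> < \<epsilon>" if n: "n \<ge> max N 1" for n
    proof -
      interpret Q: real_distribution "\<mu> n" by (rule \<mu>)
      have "g \<in> borel_measurable (\<mu> n)" using g_meas by simp
      from Q.truncated_mean_error(2)[OF this int B K] P.truncated_mean_error(2)[OF _ int2P BP K] N[of n] BK n
      have "\<bar>(\<integral>x. g x \<partial>\<mu> n) - (\<integral>x. truncate K (g x) \<partial>\<mu> n)\<bar> \<le> B / K"
        "\<bar>(\<integral>x. g x \<partial>P) - (\<integral>x. truncate K (g x) \<partial>P)\<bar> \<le> B / K"
        "\<bar>(\<integral>x. truncate K (g x) \<partial>\<mu> n) - (\<integral>x. truncate K (g x) \<partial>P)\<bar> < \<epsilon> / 3" by simp_all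
      with BK show ?thesis by linarith
    qed
    thus "\<exists>no. \<forall>n\<ge>no. norm ((\<integral>x. g x \<partial>\<mu> n) - (\<integral>x. g x \<partial>P)) < \<epsilon>" by (auto intro!: exI[of _ "max N 1"])
  qed
qed

section \<open>Weighted means and interpolation between levels\<close>

lemma powr_increment_tendsto_0:
  assumes "0 < \<theta>" "\<theta> < 1"
  shows "(\<lambda>j. real (Suc j) powr \<theta> - real j powr \<theta>) \<longlonglongrightarrow> 0"
proof (rule tendsto_sandwich)
  show "\<forall>\<^sub>F j in sequentially. 0 \<le> real (Suc j) powr \<theta> - real j powr \<theta>"
    using assms by (intro always_eventually allI) (simp add: powr_mono2)
  show "\<forall>\<^sub>F j in sequentially. real (Suc j) powr \<theta> - real j powr \<theta> \<le> \<theta> * real j powr (\<theta> - 1)"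
    using eventually_gt_at_top[of 0]
  proof eventually_elim
    case (elim j)
    have "\<exists>z::real. real j < z \<and> z < real (Suc j) \<and>
        real (Suc j) powr \<theta> - real j powr \<theta> = (real (Suc j) - real j) * (\<theta> * z powr (\<theta> - 1))"
      using elim by (intro MVT2) (auto intro!: derivative_eq_intros)
    then obtain z where z: "real j < z" "real (Suc j) powr \<theta> - real j powr \<theta> = \<theta> * z powr (\<theta> - 1)" by auto
    have "z powr (\<theta> - 1) \<le> real j powr (\<theta> - 1)" using z elim assms by (intro powr_mono2') auto
    thus ?case using z assms by simp
  qed
  have "(\<lambda>j. real j powr (\<theta> - 1)) \<longlonglongrightarrow> 0"
    using assms by (intro tendsto_neg_powr filterlim_real_sequentially) auto
  thus "(\<lambda>j. \<theta> * real j powr (\<theta> - 1)) \<longlonglongrightarrow> 0" by (rule tendsto_mult_right_zero)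
qed simp

lemma filterlim_powr_at_top:
  assumes "0 < \<theta>"
  shows "filterlim (\<lambda>x :: real. x powr \<theta>) at_top at_top"
proof -
  have "filterlim (\<lambda>x :: real. exp (\<theta> * ln x)) at_top at_top"
    using assms by (intro filterlim_compose[OF exp_at_top] filterlim_tendsto_pos_mult_at_top[OF tendsto_const] ln_at_top)
  moreover have "\<forall>\<^sub>F x :: real in at_top. exp (\<theta> * ln x) = x powr \<theta>"
    using eventually_gt_at_top[of 0] by eventually_elim (simp add: powr_def)
  ultimately show ?thesis by (simp cong: filterlim_cong)
qed

context log_weights
begin

lemma weighted_mean_tendsto:
  fixes u :: "nat \<Rightarrow> real"
  assumes "u \<longlonglongrightarrow> l"
  shows "(\<lambda>N. (\<Sum>k=1..N. d k * u k) / D N) \<longlonglongrightarrow> l"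
proof (rule LIMSEQ_I)
  fix \<epsilon> :: real assume \<epsilon>: "0 < \<epsilon>"
  from LIMSEQ_D[OF assms, of "\<epsilon> / 2"] \<epsilon> obtain K where K: "\<And>k. k \<ge> K \<Longrightarrow> \<bar>u k - l\<bar> < \<epsilon> / 2" by auto
  define S where "S = (\<Sum>k=1..K. d k * \<bar>u k - l\<bar>)"
  have bound: "\<bar>\<Sum>k=1..N. d k * (u k - l)\<bar> \<le> S + \<epsilon> / 2 * D N" for N
  proof -
    have "\<bar>\<Sum>k=1..N. d k * (u k - l)\<bar> \<le> (\<Sum>k=1..N. d k * \<bar>u k - l\<bar>)"
      using d_pos by (intro order_trans[OF sum_abs] sum_mono) (auto simp: abs_mult less_imp_le)
    also have "\<dots> \<le> (\<Sum>k=1..N. (if k \<le> K then d k * \<bar>u k - l\<bar> else 0) + \<epsilon> / 2 * d k)"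
    proof (rule sum_mono)
      fix k assume "k \<in> {1..N}"
      hence dk: "d k > 0" using d_pos by simp
      show "d k * \<bar>u k - l\<bar> \<le> (if k \<le> K then d k * \<bar>u k - l\<bar> else 0) + \<epsilon> / 2 * d k"
        using mult_left_mono[OF less_imp_le[OF K[of k]] less_imp_le[OF dk]] dk \<epsilon> by (auto simp: mult_ac)
    qed
    also have "\<dots> = (\<Sum>k=1..N. if k \<le> K then d k * \<bar>u k - l\<bar> else 0) + \<epsilon> / 2 * D N"
      by (simp add: sum.distrib sum_distrib_left weight_sum_def)
    also have "(\<Sum>k=1..N. if k \<le> K then d k * \<bar>u k - l\<bar> else 0) = (\<Sum>k\<in>{1..N} \<inter> {..K}. d k * \<bar>u k - l\<bar>)"
      by (subst sum.inter_restrict) auto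
    also have "\<dots> \<le> S"
      unfolding S_def using d_pos by (intro sum_mono2) (auto simp: less_imp_le)
    finally show ?thesis by simp
  qed
  have "\<forall>\<^sub>F N in sequentially. D N > max (2 * S / \<epsilon>) 0"
    using D_at_top unfolding filterlim_at_top_dense by blast
  then obtain N0 where N0: "\<And>N. N \<ge> N0 \<Longrightarrow> D N > max (2 * S / \<epsilon>) 0" by (auto simp: eventually_sequentially)
  have "\<bar>(\<Sum>k=1..N. d k * u k) / D N - l\<bar> < \<epsilon>" if N: "N \<ge> N0" for N
  proof -
    have DN: "D N > 0" "2 * S / \<epsilon> < D N" using N0[OF N] by auto
    have "(\<Sum>k=1..N. d k * u k) / D N - l = (\<Sum>k=1..N. d k * (u k - l)) / D N"
      using DN by (simp add: right_diff_distrib sum_subtractf sum_distrib_right[symmetric] diff_divide_distrib weight_sum_def)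
    hence "\<bar>(\<Sum>k=1..N. d k * u k) / D N - l\<bar> \<le> (S + \<epsilon> / 2 * D N) / D N"
      using bound[of N] DN by (simp add: divide_right_mono)
    also have "\<dots> < \<epsilon>" using DN \<epsilon> by (simp add: field_simps)
    finally show ?thesis .
  qed
  thus "\<exists>no. \<forall>N\<ge>no. norm ((\<Sum>k=1..N. d k * u k) / D N - l) < \<epsilon>" by auto
qed

definition level_index :: "real \<Rightarrow> nat \<Rightarrow> nat" where
  "level_index \<theta> j = (LEAST N. exp (real j powr \<theta>) \<le> D N)"

lemma D_level_index_ge: "exp (real j powr \<theta>) \<le> D (level_index \<theta> j)"
proof -
  have "\<forall>\<^sub>F N in sequentially. exp (real j powr \<theta>) \<le> D N" using D_at_top by (simp add: filterlim_at_top)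
  then obtain N where "exp (real j powr \<theta>) \<le> D N" by (auto simp: eventually_sequentially)
  thus ?thesis unfolding level_index_def by (rule LeastI)
qed

lemma level_index_le: "exp (real j powr \<theta>) \<le> D N \<Longrightarrow> level_index \<theta> j \<le> N"
  unfolding level_index_def by (rule Least_le)

lemma D_0: "D 0 = 0" by (simp add: weight_sum_def)

lemma level_index_pos: "1 \<le> level_index \<theta> j"
  using D_level_index_ge[of j \<theta>] D_0 exp_gt_zero[of "real j powr \<theta>"] by (cases "level_index \<theta> j") auto

lemma D_mono: "m \<le> n \<Longrightarrow> D m \<le> D n"
  by (rule weight_sum_mono[OF d_pos])

lemma level_at_top:
  assumes "0 < \<theta>"
  shows "filterlim (\<lambda>j. exp (real j powr \<theta>)) at_top sequentially"
proof (rule filterlim_compose[OF exp_at_top])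
  show "filterlim (\<lambda>j. real j powr \<theta>) at_top sequentially"
    by (rule filterlim_compose[OF filterlim_powr_at_top[OF assms] filterlim_real_sequentially])
qed

lemma level_index_at_top:
  assumes "0 < \<theta>"
  shows "filterlim (level_index \<theta>) at_top sequentially"
  unfolding filterlim_at_top
proof
  fix n
  have "\<forall>\<^sub>F j in sequentially. D n < exp (real j powr \<theta>)"
    using level_at_top[OF assms] by (simp add: filterlim_at_top_dense)
  thus "\<forall>\<^sub>F j in sequentially. n \<le> level_index \<theta> j"
  proof eventually_elim
    case (elim j)
    show ?case
    proof (rule ccontr)
      assume "\<not> n \<le> level_index \<theta> j"
      hence "D (level_index \<theta> j) \<le> D n" by (intro D_mono) simp
      thus False using D_level_index_ge[of j \<theta>] elim by simp
    qed
  qed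
qed

text \<open>The total weight overshoots the level by at most one weight, which is negligible against the total.\<close>

lemma D_level_index_asymp:
  assumes \<theta>: "0 < \<theta>"
  shows "(\<lambda>j. D (level_index \<theta> j) / exp (real j powr \<theta>)) \<longlonglongrightarrow> 1"
proof (rule tendsto_sandwich)
  let ?N = "level_index \<theta>"
  show "\<forall>\<^sub>F j in sequentially. 1 \<le> D (?N j) / exp (real j powr \<theta>)"
    using D_level_index_ge by (intro always_eventually allI) simp
  have lim: "(\<lambda>j. d (?N j) / D (?N j)) \<longlonglongrightarrow> 0"
    by (rule filterlim_compose[OF d_div_D_tendsto_0 level_index_at_top[OF \<theta>]])
  hence "\<forall>\<^sub>F j in sequentially. d (?N j) / D (?N j) < 1" by (rule order_tendstoD) simp
  thus "\<forall>\<^sub>F j in sequentially. D (?N j) / exp (real j powr \<theta>) \<le> 1 / (1 - d (?N j) / D (?N j))"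
  proof eventually_elim
    case (elim j)
    define q where "q = d (?N j) / D (?N j)"
    obtain n where n: "?N j = Suc n" using level_index_pos[of \<theta> j] by (cases "?N j") auto
    have DN: "D (?N j) > 0" by (rule weight_sum_pos[OF d_pos level_index_pos])
    have "\<not> exp (real j powr \<theta>) \<le> D n"
      using level_index_le[of j \<theta> n] n by auto
    hence "D (?N j) - d (?N j) < exp (real j powr \<theta>)" using n weight_sum_Suc[of d n] by simp
    hence "D (?N j) * (1 - q) \<le> exp (real j powr \<theta>)" using DN by (simp add: q_def right_diff_distrib)
    thus ?case using elim by (simp add: q_def[symmetric] field_simps)
  qed
  have "(\<lambda>j. 1 / (1 - d (?N j) / D (?N j))) \<longlonglongrightarrow> 1 / (1 - 0)"
    by (intro tendsto_intros lim) auto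
  thus "(\<lambda>j. 1 / (1 - d (?N j) / D (?N j))) \<longlonglongrightarrow> 1" by simp
qed simp

text \<open>If \<open>D\<^sub>N\<close> lies between two consecutive levels, then \<open>A\<^sub>N / D\<^sub>N\<close> lies between the values of \<open>A\<close> at the two
corresponding indices divided by the opposite levels. Both bounds converge to the same limit since consecutive
levels have ratio tending to one, for which \<open>\<theta> < 1\<close> is essential.\<close>

lemma convergence_along_levels:
  fixes A :: "nat \<Rightarrow> real"
  assumes \<theta>: "0 < \<theta>" "\<theta> < 1" and A: "mono A" "\<And>n. 0 \<le> A n"
    and lim: "(\<lambda>j. A (level_index \<theta> j) / D (level_index \<theta> j)) \<longlonglongrightarrow> l"
  shows "(\<lambda>N. A N / D N) \<longlonglongrightarrow> l"
proof -
  let ?N = "level_index \<theta>"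
  define e where "e j = exp (real j powr \<theta>)" for j
  have e_pos: "e j > 0" for j by (simp add: e_def)
  have DN: "D (?N j) > 0" for j by (rule weight_sum_pos[OF d_pos level_index_pos])
  have lim_e: "(\<lambda>j. A (?N j) / e j) \<longlonglongrightarrow> l"
  proof -
    have "(\<lambda>j. (A (?N j) / D (?N j)) * (D (?N j) / e j)) \<longlonglongrightarrow> l * 1"
      unfolding e_def by (intro tendsto_mult lim D_level_index_asymp \<theta>)
    thus ?thesis using DN by (simp add: less_imp_neq[THEN not_sym])
  qed
  have ratio: "(\<lambda>j. e (Suc j) / e j) \<longlonglongrightarrow> 1"
    using tendsto_exp[OF powr_increment_tendsto_0[OF \<theta>]] by (simp add: e_def exp_diff)
  have upper: "(\<lambda>j. A (?N (Suc j)) / e j) \<longlonglongrightarrow> l"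
  proof -
    have "(\<lambda>j. (A (?N (Suc j)) / e (Suc j)) * (e (Suc j) / e j)) \<longlonglongrightarrow> l * 1"
      by (intro tendsto_mult ratio LIMSEQ_Suc[OF lim_e])
    thus ?thesis by (simp add: e_def)
  qed
  have lower: "(\<lambda>j. A (?N j) / e (Suc j)) \<longlonglongrightarrow> l"
  proof -
    have "(\<lambda>j. (A (?N j) / e j) / (e (Suc j) / e j)) \<longlonglongrightarrow> l / 1"
      by (intro tendsto_divide ratio lim_e) simp
    thus ?thesis by (simp add: e_def)
  qed
  \<comment> \<open>the number of the last level that \<open>D N\<close> has reached\<close>
  define J where "J N = nat \<lfloor>ln (D N) powr (1 / \<theta>)\<rfloor>" for N
  have J_top: "filterlim J at_top sequentially"
    unfolding J_def
    by (intro filterlim_compose[OF filterlim_nat_sequentially] filterlim_compose[OF filterlim_floor_sequentially]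
       filterlim_compose[OF filterlim_powr_at_top] filterlim_compose[OF ln_at_top D_at_top]) (use \<theta> in auto)
  have ev: "\<forall>\<^sub>F N in sequentially. D N \<ge> 1" using D_at_top by (simp add: filterlim_at_top)
  have sandwich: "e (J N) \<le> D N \<and> D N \<le> e (Suc (J N))" if N: "D N \<ge> 1" for N
  proof -
    define x where "x = ln (D N) powr (1 / \<theta>)"
    have x0: "x \<ge> 0" by (simp add: x_def)
    have ln0: "ln (D N) \<ge> 0" using N by simp
    have x\<theta>: "x powr \<theta> = ln (D N)" using \<theta> ln0 by (simp add: x_def powr_powr)
    have J: "real (J N) \<le> x" "x \<le> real (Suc (J N))" using x0 by (simp_all add: J_def x_def[symmetric]) linarith
    have "real (J N) powr \<theta> \<le> ln (D N)" using J(1) \<theta> by (simp add: x\<theta>[symmetric] powr_mono2)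
    moreover have "ln (D N) \<le> real (Suc (J N)) powr \<theta>" using J(2) \<theta> x0 by (simp only: x\<theta>[symmetric]) (intro powr_mono2, auto)
    ultimately have "e (J N) \<le> exp (ln (D N))" "exp (ln (D N)) \<le> e (Suc (J N))"
      unfolding e_def exp_le_cancel_iff .
    thus ?thesis using N by simp
  qed
  show ?thesis
  proof (rule tendsto_sandwich)
    show "(\<lambda>N. A (?N (J N)) / e (Suc (J N))) \<longlonglongrightarrow> l" by (rule filterlim_compose[OF lower J_top])
    show "(\<lambda>N. A (?N (Suc (J N))) / e (J N)) \<longlonglongrightarrow> l" by (rule filterlim_compose[OF upper J_top])
    show "\<forall>\<^sub>F N in sequentially. A (?N (J N)) / e (Suc (J N)) \<le> A N / D N" using ev
    proof eventually_elim
      case (elim N)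
      have "?N (J N) \<le> N" using sandwich[OF elim] by (intro level_index_le) (simp add: e_def)
      thus ?case using sandwich[OF elim] elim A e_pos by (intro frac_le) (auto simp: mono_def)
    qed
    show "\<forall>\<^sub>F N in sequentially. A N / D N \<le> A (?N (Suc (J N))) / e (J N)"
      using eventually_conj[OF ev eventually_conj[OF eventually_gt_at_top[of 0] filterlim_at_top_dense[THEN iffD1, OF D_at_top, rule_format, of 1]]]
    proof eventually_elim
      case (elim N)
      have le: "e (J N) \<le> D N" "D N \<le> e (Suc (J N))" using sandwich elim by auto
      have "A N \<le> A (?N (Suc (J N)))"
      proof (rule monoD[OF A(1)], rule ccontr)
        assume "\<not> N \<le> ?N (Suc (J N))"
        then obtain n where n: "N = Suc n" "?N (Suc (J N)) \<le> n" by (cases N) auto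
        have "e (Suc (J N)) \<le> D n" using D_level_index_ge[of "Suc (J N)" \<theta>] D_mono[OF n(2)] by (simp add: e_def)
        thus False using le weight_sum_Suc[of d n] d_pos[of N] n by simp
      qed
      thus ?case using le A e_pos by (intro frac_le) auto
    qed
  qed
qed

end

section \<open>Almost sure convergence\<close>

text \<open>By monotone convergence the series of the powers has finite expectation, hence converges almost surely,
and its terms tend to zero.\<close>

lemma (in prob_space) AE_tendsto_0_of_summable_moments:
  assumes fm: "\<And>j. finite_moment (2 * m) (Z j)"
    and sum: "summable (\<lambda>j. expectation (\<lambda>\<omega>. Z j \<omega> ^ (2 * m)))" and m: "1 \<le> m"
  shows "AE \<omega> in M. (\<lambda>j. Z j \<omega>) \<longlonglongrightarrow> 0"
proof -
  have [measurable]: "Z j \<in> borel_measurable M" for j by (rule finite_moment_measurable[OF fm])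
  have int: "integrable M (\<lambda>\<omega>. Z j \<omega> ^ (2 * m))" for j
    by (rule finite_moment_integrable_power[OF fm]) simp
  have nn: "0 \<le> expectation (\<lambda>\<omega>. Z j \<omega> ^ (2 * m))" for j
    by (intro Bochner_Integration.integral_nonneg) simp
  have "(\<integral>\<^sup>+\<omega>. (\<Sum>j. ennreal (Z j \<omega> ^ (2 * m))) \<partial>M) = (\<Sum>j. \<integral>\<^sup>+\<omega>. ennreal (Z j \<omega> ^ (2 * m)) \<partial>M)"
    by (rule nn_integral_suminf) simp
  also have "\<dots> = (\<Sum>j. ennreal (expectation (\<lambda>\<omega>. Z j \<omega> ^ (2 * m))))"
    using int by (intro suminf_cong nn_integral_eq_integral) auto
  also have "\<dots> = ennreal (\<Sum>j. expectation (\<lambda>\<omega>. Z j \<omega> ^ (2 * m)))"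
    by (rule suminf_ennreal_eq[OF nn]) (rule summable_sums[OF sum])
  finally have "(\<integral>\<^sup>+\<omega>. (\<Sum>j. ennreal (Z j \<omega> ^ (2 * m))) \<partial>M) \<noteq> \<infinity>" by simp
  hence "AE \<omega> in M. (\<Sum>j. ennreal (Z j \<omega> ^ (2 * m))) \<noteq> \<infinity>"
    by (intro nn_integral_PInf_AE) auto
  thus ?thesis
  proof eventually_elim
    case (elim \<omega>)
    have "summable (\<lambda>j. Z j \<omega> ^ (2 * m))"
      using elim by (intro summable_suminf_not_top) auto
    hence "(\<lambda>j. \<bar>Z j \<omega>\<bar> ^ (2 * m)) \<longlonglongrightarrow> 0"
      using summable_LIMSEQ_zero by (simp add: power_even_abs)
    hence "(\<lambda>j. root (2 * m) (\<bar>Z j \<omega>\<bar> ^ (2 * m))) \<longlonglongrightarrow> root (2 * m) 0"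
      by (rule tendsto_real_root)
    hence "(\<lambda>j. \<bar>Z j \<omega>\<bar>) \<longlonglongrightarrow> 0" using m by (simp add: real_root_power_cancel)
    thus ?case by (simp add: tendsto_rabs_zero_iff)
  qed
qed

locale weighted_walk = normalized_walk + log_weights +
  fixes C\<^sub>a \<beta> :: real
  assumes \<beta>_pos: "0 < \<beta>" and Ca_pos: "0 < C\<^sub>a"
    and a_ratio: "\<And>k l. 1 \<le> k \<Longrightarrow> k \<le> l \<Longrightarrow> a k / a l \<le> C\<^sub>a * (real k / real l) powr \<beta>"
    and m_large: "1 < real m * \<rho>"
begin

definition weighted_total :: "(real \<Rightarrow> real) \<Rightarrow> nat \<Rightarrow> 'a \<Rightarrow> real" where
  "weighted_total f N \<omega> = (\<Sum>k=1..N. d k * f (Y k \<omega>))"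

lemma finite_moment_weighted_total:
  assumes "L-lipschitz_on UNIV f"
  shows "finite_moment (2 * m) (weighted_total f N)"
  unfolding weighted_total_def[abs_def]
  by (intro finite_moment_sum finite_moment_cmult finite_moment_lipschitz[OF finite_moment_Y assms])

text \<open>Dividing by \<open>D\<^sub>N\<close> turns the bound \<open>O((D\<^sub>N\<^sup>2 / (log D\<^sub>N)\<^sup>\<rho>)\<^sup>m)\<close> into a negative power of the logarithm.\<close>

lemma weighted_total_moment:
  assumes f: "L-lipschitz_on UNIV f"
  shows "\<exists>C\<ge>0. \<forall>N\<ge>1. expectation (\<lambda>\<omega>. ((weighted_total f N \<omega> - expectation (weighted_total f N)) / D N) ^ (2 * m))
    \<le> C * lnD N powr (- (real m * \<rho>))"
proof -
  obtain C where C: "C \<ge> 0" "\<And>d N. (\<And>k. k \<ge> 1 \<Longrightarrow> 0 \<le> d k) \<Longrightarrow>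
    expectation (\<lambda>\<omega>. ((\<Sum>k=1..N. d k * f (Y k \<omega>)) - expectation (\<lambda>\<omega>. \<Sum>k=1..N. d k * f (Y k \<omega>))) ^ (2 * m))
      \<le> C * (\<Sum>l=1..N. \<Sum>k=1..l. d k * d l * (a k / a l)) ^ m"
    using weighted_lipschitz_sum_moment[OF f] by blast
  obtain C' where C': "C' \<ge> 0" "\<And>N. N \<ge> 1 \<Longrightarrow>
      (\<Sum>l=1..N. \<Sum>k=1..l. d k * d l * (real k / real l) powr \<beta>) \<le> C' * ((D N)\<^sup>2 / lnD N powr \<rho>)"
    using weighted_correlation_sum_le[OF \<beta>_pos] by blast
  have "expectation (\<lambda>\<omega>. ((weighted_total f N \<omega> - expectation (weighted_total f N)) / D N) ^ (2 * m))
    \<le> C * (C\<^sub>a * C') ^ m * lnD N powr (- (real m * \<rho>))" if N: "N \<ge> 1" for N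
  proof -
    have DN: "D N > 0" by (rule weight_sum_pos[OF d_pos N])
    have lnDm: "(lnD N powr \<rho>) ^ m = lnD N powr (real m * \<rho>)"
      using lnD_pos[of N] by (simp add: powr_powr[symmetric] powr_realpow[symmetric] mult.commute)
    have dnn: "0 \<le> d k" if "k \<ge> 1" for k using d_pos[OF that] by simp
    have "(\<Sum>l=1..N. \<Sum>k=1..l. d k * d l * (a k / a l)) \<le> (\<Sum>l=1..N. \<Sum>k=1..l. d k * d l * (C\<^sub>a * (real k / real l) powr \<beta>))"
      by (intro sum_mono mult_left_mono a_ratio mult_nonneg_nonneg dnn) auto
    also have "\<dots> = C\<^sub>a * (\<Sum>l=1..N. \<Sum>k=1..l. d k * d l * (real k / real l) powr \<beta>)"
      by (simp add: sum_distrib_left mult_ac)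
    also have "\<dots> \<le> C\<^sub>a * (C' * ((D N)\<^sup>2 / lnD N powr \<rho>))"
      using C'(2)[OF N] Ca_pos by (intro mult_left_mono) auto
    finally have le: "(\<Sum>l=1..N. \<Sum>k=1..l. d k * d l * (a k / a l)) \<le> C\<^sub>a * C' * ((D N)\<^sup>2 / lnD N powr \<rho>)"
      by (simp add: mult.assoc)
    have "expectation (\<lambda>\<omega>. (weighted_total f N \<omega> - expectation (weighted_total f N)) ^ (2 * m))
        \<le> C * (\<Sum>l=1..N. \<Sum>k=1..l. d k * d l * (a k / a l)) ^ m"
      unfolding weighted_total_def[abs_def] by (rule C(2)) (rule dnn)
    also have "\<dots> \<le> C * (C\<^sub>a * C' * ((D N)\<^sup>2 / lnD N powr \<rho>)) ^ m"
      using C(1) le dnn a_pos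
      by (intro mult_left_mono power_mono sum_nonneg mult_nonneg_nonneg divide_nonneg_nonneg) (auto simp: less_imp_le)
    also have "\<dots> = C * (C\<^sub>a * C') ^ m * lnD N powr (- (real m * \<rho>)) * D N ^ (2 * m)"
      by (simp add: power_mult_distrib power_divide lnDm powr_minus power_mult divide_inverse power_inverse)
    finally show ?thesis using DN by (simp add: power_divide pos_divide_le_eq)
  qed
  moreover have "C * (C\<^sub>a * C') ^ m \<ge> 0" using C(1) C'(1) Ca_pos by simp
  ultimately show ?thesis by blast
qed

text \<open>At the index of level \<open>j\<close> the logarithm of the total weight is at least \<open>j\<^sup>\<theta>\<close>, so the moments are bounded
by a multiple of \<open>j\<^bsup>- \<theta> m \<rho>\<^esup>\<close> and are summable.\<close>

lemma AE_tendsto_along_levels: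
  assumes f: "L-lipschitz_on UNIV f" and lim: "(\<lambda>n. expectation (\<lambda>\<omega>. f (Y n \<omega>))) \<longlonglongrightarrow> l"
    and \<theta>: "0 < \<theta>" "1 < \<theta> * (real m * \<rho>)"
  shows "AE \<omega> in M. (\<lambda>j. weighted_total f (level_index \<theta> j) \<omega> / D (level_index \<theta> j)) \<longlonglongrightarrow> l"
proof -
  let ?N = "level_index \<theta>"
  define e where "e N = expectation (weighted_total f N)" for N
  define Z where "Z j \<omega> = (weighted_total f (?N j) \<omega> - e (?N j)) / D (?N j)" for j \<omega>
  have fmZ: "finite_moment (2 * m) (Z j)" for j
    using finite_moment_cmult[OF finite_moment_diff[OF finite_moment_weighted_total[OF f] finite_moment_const], of "1 / D (?N j)" "?N j" "e (?N j)"]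
    by (simp add: Z_def[abs_def])
  obtain C where C: "C \<ge> 0" "\<And>N. N \<ge> 1 \<Longrightarrow> expectation (\<lambda>\<omega>. ((weighted_total f N \<omega> - e N) / D N) ^ (2 * m))
    \<le> C * lnD N powr (- (real m * \<rho>))"
    using weighted_total_moment[OF f] unfolding e_def by blast
  have Z0: "AE \<omega> in M. (\<lambda>j. Z j \<omega>) \<longlonglongrightarrow> 0"
  proof (rule AE_tendsto_0_of_summable_moments[OF fmZ _ m])
    have "summable (\<lambda>j. C * real j powr (- (\<theta> * (real m * \<rho>))))"
      using \<theta> by (intro summable_mult) (simp add: summable_real_powr_iff)
    moreover have "\<forall>\<^sub>F j in sequentially. norm (expectation (\<lambda>\<omega>. Z j \<omega> ^ (2 * m))) \<le> C * real j powr (- (\<theta> * (real m * \<rho>)))"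
      using eventually_gt_at_top[of 0]
    proof eventually_elim
      case (elim j)
      have "real j powr \<theta> \<le> ln (D (?N j))"
        using D_level_index_ge[of j \<theta>] weight_sum_pos[OF d_pos level_index_pos[of \<theta> j]]
        by (simp add: ln_ge_iff)
      also have "\<dots> \<le> lnD (?N j)"
        unfolding lnD_def using weight_sum_pos[OF d_pos level_index_pos[of \<theta> j]] by (subst ln_le_cancel_iff) (auto simp: add_pos_pos)
      finally have le: "real j powr \<theta> \<le> lnD (?N j)" .
      have "norm (expectation (\<lambda>\<omega>. Z j \<omega> ^ (2 * m))) = expectation (\<lambda>\<omega>. Z j \<omega> ^ (2 * m))"
        by simp
      also have "\<dots> \<le> C * lnD (?N j) powr (- (real m * \<rho>))"
        unfolding Z_def by (rule C(2)[OF level_index_pos])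
      also have "\<dots> \<le> C * (real j powr \<theta>) powr (- (real m * \<rho>))"
        using C(1) le elim \<rho>_pos by (intro mult_left_mono powr_mono2') auto
      finally show ?case by (simp add: powr_powr)
    qed
    ultimately show "summable (\<lambda>j. expectation (\<lambda>\<omega>. Z j \<omega> ^ (2 * m)))"
      by (rule summable_comparison_test_ev[rotated])
  qed
  have mean: "(\<lambda>j. e (?N j) / D (?N j)) \<longlonglongrightarrow> l"
  proof -
    have "e N = (\<Sum>k=1..N. d k * expectation (\<lambda>\<omega>. f (Y k \<omega>)))" for N
    proof -
      have "integrable M (\<lambda>\<omega>. f (Y k \<omega>))" for k
        by (rule finite_moment_integrable[OF finite_moment_lipschitz[OF finite_moment_Y f]]) (use m in simp)
      thus ?thesis by (simp add: e_def weighted_total_def[abs_def])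
    qed
    hence "(\<lambda>N. e N / D N) \<longlonglongrightarrow> l" using weighted_mean_tendsto[OF lim] by simp
    thus ?thesis by (rule filterlim_compose[OF _ level_index_at_top[OF \<theta>(1)]])
  qed
  from Z0 show ?thesis
  proof eventually_elim
    case (elim \<omega>)
    have "(\<lambda>j. Z j \<omega> + e (?N j) / D (?N j)) \<longlonglongrightarrow> 0 + l" by (intro tendsto_add elim mean)
    thus ?case by (simp add: Z_def diff_divide_distrib)
  qed
qed

lemma AE_tendsto_nonneg:
  assumes f: "L-lipschitz_on UNIV f" "\<And>x. 0 \<le> f x" and lim: "(\<lambda>n. expectation (\<lambda>\<omega>. f (Y n \<omega>))) \<longlonglongrightarrow> l"
  shows "AE \<omega> in M. (\<lambda>N. weighted_total f N \<omega> / D N) \<longlonglongrightarrow> l"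
proof -
  \<comment> \<open>the midpoint of the admissible range, which is nonempty as \<open>m \<rho> > 1\<close>\<close>
  define \<theta> where "\<theta> = (1 + 1 / (real m * \<rho>)) / 2"
  have \<theta>: "0 < \<theta>" "\<theta> < 1" "1 < \<theta> * (real m * \<rho>)"
  proof -
    define q where "q = real m * \<rho>"
    have "q > 1" using m_large by (simp add: q_def)
    thus "0 < \<theta>" "\<theta> < 1" "1 < \<theta> * (real m * \<rho>)"
      unfolding \<theta>_def q_def[symmetric] by (auto simp: field_simps add_pos_pos)
  qed
  show ?thesis using AE_tendsto_along_levels[OF f(1) lim \<theta>(1,3)]
  proof eventually_elim
    case (elim \<omega>)
    show ?case
    proof (rule convergence_along_levels[OF \<theta>(1,2) _ _ elim])
      show "mono (\<lambda>N. weighted_total f N \<omega>)"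
        unfolding weighted_total_def mono_def using d_pos f(2)
        by (intro allI impI sum_mono2) (auto intro!: mult_nonneg_nonneg simp: less_imp_le)
      show "0 \<le> weighted_total f N \<omega>" for N
        unfolding weighted_total_def using d_pos f(2) by (intro sum_nonneg) (auto intro!: mult_nonneg_nonneg simp: less_imp_le)
    qed
  qed
qed

text \<open>Only for nonnegative functions is the weighted total monotone in \<open>N\<close>, hence the splitting into
positive and negative part.\<close>

lemma AE_tendsto:
  assumes f: "L-lipschitz_on UNIV f" and P: "integrable P f"
    and lim: "\<And>(g :: real \<Rightarrow> real) L. L-lipschitz_on UNIV g \<Longrightarrow> (\<lambda>n. expectation (\<lambda>\<omega>. g (Y n \<omega>))) \<longlonglongrightarrow> (\<integral>x. g x \<partial>P)"
  shows "AE \<omega> in M. (\<lambda>N. weighted_total f N \<omega> / D N) \<longlonglongrightarrow> (\<integral>x. f x \<partial>P)"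
proof -
  define p n where "p x = max (f x) 0" and "n x = max (- f x) 0" for x
  have L: "L \<ge> 0" by (rule lipschitz_on_nonneg[OF f])
  have lip: "L-lipschitz_on UNIV p" "L-lipschitz_on UNIV n"
    using lipschitz_onD[OF f] L by (auto intro!: lipschitz_onI simp: p_def n_def dist_real_def max_def abs_le_iff) (smt (verit) UNIV_I)+
  have f_eq: "f x = p x - n x" for x by (simp add: p_def n_def max_def)
  have int: "integrable P p" "integrable P n" unfolding p_def n_def using P by auto
  have "AE \<omega> in M. (\<lambda>N. weighted_total p N \<omega> / D N) \<longlonglongrightarrow> (\<integral>x. p x \<partial>P)"
    by (rule AE_tendsto_nonneg[OF lip(1) _ lim[OF lip(1)]]) (simp add: p_def)
  moreover have "AE \<omega> in M. (\<lambda>N. weighted_total n N \<omega> / D N) \<longlonglongrightarrow> (\<integral>x. n x \<partial>P)"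
    by (rule AE_tendsto_nonneg[OF lip(2) _ lim[OF lip(2)]]) (simp add: n_def)
  ultimately show ?thesis
  proof eventually_elim
    case (elim \<omega>)
    have "(\<lambda>N. weighted_total p N \<omega> / D N - weighted_total n N \<omega> / D N) \<longlonglongrightarrow> (\<integral>x. p x \<partial>P) - (\<integral>x. n x \<partial>P)"
      by (intro tendsto_diff elim)
    thus ?case using int
      by (simp add: f_eq weighted_total_def right_diff_distrib sum_subtractf diff_divide_distrib)
  qed
qed

end

text \<open>It remains to derive the hypotheses of the preceding results. The order \<open>2 m\<close> with \<open>m = \<mu> div 2\<close> is at
least \<open>\<mu> / 2\<close>, whence \<open>4 m \<rho> \<ge> \<mu> \<rho> > \<mu> (\<rho> - r) \<ge> 4\<close>. The moment condition concerns only large indices;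
independence extends it to all summands, and thus a uniform bound holds for all normalized sums.\<close>

theorem theorem1p1:
  fixes M :: "'a measure"
    and X :: "nat \<Rightarrow> 'a \<Rightarrow> real"
    and a b d :: "nat \<Rightarrow> real"
    and H :: "real \<Rightarrow> real"
    and \<rho> r :: real and \<mu> :: nat
  assumes "prob_space M"
    and indep: "prob_space.indep_vars M (\<lambda>_. borel) X {1..}"
    and d_pos: "\<And>k. k \<ge> 1 \<Longrightarrow> d k > 0"
    and a_pos: "\<And>n. n \<ge> 1 \<Longrightarrow> a n > 0"
    and C1: "distribution_function H"
            "weak_conv (\<lambda>n. cdf (distr M borel (normalized_sum X a b n))) H"
    and C2: "liminf (\<lambda>k. ereal (real k * d k)) > 0"
            "\<exists>\<alpha>. 0 < \<alpha> \<and> \<alpha> < 1 \<and> (\<exists>K. antimono_on {K..} (\<lambda>k. d k * real k powr \<alpha>))"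
    and C3: "\<rho> > 0"
            "d \<in> O(\<lambda>k. weight_sum d k / (real k * ln (weight_sum d k) powr \<rho>))"
    and C4: "\<exists>C \<beta>. C > 0 \<and> \<beta> > 0 \<and>
               (\<forall>k l. 1 \<le> k \<and> k \<le> l \<longrightarrow> a k / a l \<le> C * (real k / real l) powr \<beta>)"
            "0 < r" "r < \<rho>" "real \<mu> \<ge> max 2 (4 / (\<rho> - r))"
            "\<forall>\<^sub>F n in sequentially. integrable M (\<lambda>\<omega>. \<bar>normalized_sum X a b n \<omega>\<bar> ^ \<mu>)"
            "(\<lambda>n. \<integral>\<omega>. \<bar>normalized_sum X a b n \<omega>\<bar> ^ \<mu> \<partial>M) \<in> O(\<lambda>_. 1)"
  shows "\<forall>f :: real \<Rightarrow> real. (\<exists>L. L-lipschitz_on UNIV f) \<longrightarrow>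
           integrable (interval_measure H) f \<and>
           (AE \<omega> in M.
              (\<lambda>N. (\<Sum>k=1..N. d k * f (normalized_sum X a b k \<omega>)) / weight_sum d N)
                \<longlonglongrightarrow> (\<integral>x. f x \<partial>interval_measure H))"
proof -
  interpret prob_space M by fact
  have X_meas [measurable]: "X i \<in> borel_measurable M" if "1 \<le> i" for i
    using indep that by (auto simp: indep_vars_def)
  define m where "m = \<mu> div 2"
  have \<mu>: "2 \<le> \<mu>" "4 \<le> real \<mu> * (\<rho> - r)"
    using C4(3,4) by (auto simp: field_simps)
  have m: "1 \<le> m" "2 * m \<le> \<mu>" "\<mu> \<le> 4 * m" using \<mu>(1) by (auto simp: m_def)
  have m_large: "1 < real m * \<rho>"
  proof -
    have "4 \<le> real \<mu> * (\<rho> - r)" by (rule \<mu>(2))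
    also have "\<dots> < real \<mu> * \<rho>" using \<mu>(1) C4(2) by (intro mult_strict_left_mono) auto
    also have "\<dots> \<le> real (4 * m) * \<rho>" using m(3) C3(1) by (intro mult_right_mono) (simp_all only: of_nat_le_iff)
    finally show ?thesis by simp
  qed
  let ?Y = "normalized_sum X a b"
  have Y_meas [measurable]: "?Y n \<in> borel_measurable M" for n
    unfolding normalized_sum_def[abs_def] partial_sum_def[abs_def] by measurable
  obtain n\<^sub>0 where n\<^sub>0: "\<And>n. n \<ge> n\<^sub>0 \<Longrightarrow> integrable M (\<lambda>\<omega>. \<bar>?Y n \<omega>\<bar> ^ \<mu>)"
    using C4(5) by (auto simp: eventually_sequentially)
  have fmY: "finite_moment (2 * m) (?Y n)" if "n \<ge> n\<^sub>0" for n
    by (rule finite_moment_mono[of \<mu>]) (use n\<^sub>0[OF that] m(2) in \<open>auto simp: finite_moment_def\<close>)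
  have fmX: "finite_moment (2 * m) (X i)" if i: "1 \<le> i" for i
  proof -
    define n where "n = max n\<^sub>0 i"
    have n: "n \<ge> n\<^sub>0" "i \<in> {1..n}" "1 \<le> n" using i by (auto simp: n_def)
    have "partial_sum X n \<omega> = a n * ?Y n \<omega> + a n * b n" for \<omega>
      using a_pos[OF n(3)] by (simp add: normalized_sum_def field_simps)
    moreover have "finite_moment (2 * m) (\<lambda>\<omega>. a n * ?Y n \<omega> + a n * b n)"
      by (intro finite_moment_add finite_moment_cmult fmY n finite_moment_const)
    moreover have "partial_sum X n \<omega> = X i \<omega> + (\<Sum>j\<in>{1..n} - {i}. X j \<omega>)" for \<omega>
      unfolding partial_sum_def using n by (subst sum.remove[of _ i]) auto
    ultimately have fm: "finite_moment (2 * m) (\<lambda>\<omega>. X i \<omega> + (\<Sum>j\<in>{1..n} - {i}. X j \<omega>))" by simp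
    have "indep_var borel (X i) borel (\<lambda>\<omega>. \<Sum>j\<in>{1..n} - {i}. X j \<omega>)"
      by (rule indep_vars_sum) (use n i in \<open>auto intro: indep_vars_subset[OF indep]\<close>)
    thus ?thesis using fm by (rule finite_moment_if_indep_sum)
  qed
  obtain C\<^sub>0 where C\<^sub>0: "\<And>n. 1 \<le> n \<Longrightarrow> expectation (\<lambda>\<omega>. ?Y n \<omega> ^ (2 * m)) \<le> C\<^sub>0"
  proof -
    obtain c where c: "\<forall>\<^sub>F n in sequentially. norm (\<integral>\<omega>. \<bar>?Y n \<omega>\<bar> ^ \<mu> \<partial>M) \<le> c * norm (1 :: real)"
      using C4(6) by (elim landau_o.bigE)
    have "\<forall>\<^sub>F n in sequentially. expectation (\<lambda>\<omega>. ?Y n \<omega> ^ (2 * m)) \<le> (1 + c) * 1"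
      using c eventually_ge_at_top[of n\<^sub>0]
    proof eventually_elim
      case (elim n)
      have "expectation (\<lambda>\<omega>. ?Y n \<omega> ^ (2 * m)) \<le> expectation (\<lambda>\<omega>. 1 + \<bar>?Y n \<omega>\<bar> ^ \<mu>)"
      proof (rule integral_mono)
        show "integrable M (\<lambda>\<omega>. ?Y n \<omega> ^ (2 * m))"
          by (rule finite_moment_integrable_power[OF fmY[OF elim(2)]]) simp
        show "integrable M (\<lambda>\<omega>. 1 + \<bar>?Y n \<omega>\<bar> ^ \<mu>)" using n\<^sub>0[OF elim(2)] by simp
        show "?Y n \<omega> ^ (2 * m) \<le> 1 + \<bar>?Y n \<omega>\<bar> ^ \<mu>" for \<omega>
          using power_le_one_plus_power[OF abs_ge_zero m(2), of "?Y n \<omega>"] by (simp add: power_even_abs)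
      qed
      also have "\<dots> = 1 + expectation (\<lambda>\<omega>. \<bar>?Y n \<omega>\<bar> ^ \<mu>)" using n\<^sub>0[OF elim(2)] by (simp add: prob_space)
      also have "\<dots> \<le> (1 + c) * 1" using elim(1) by simp
      finally show ?case .
    qed
    from eventually_bound_imp_uniform_bound[OF this] obtain C' where
      "\<forall>k\<ge>1. expectation (\<lambda>\<omega>. ?Y k \<omega> ^ (2 * m)) \<le> C' * 1" by auto
    thus ?thesis by (intro that[of C']) simp
  qed
  obtain C\<^sub>a \<beta> where C\<^sub>a: "C\<^sub>a > 0" "\<beta> > 0" "\<And>k l. 1 \<le> k \<Longrightarrow> k \<le> l \<Longrightarrow> a k / a l \<le> C\<^sub>a * (real k / real l) powr \<beta>"
    using C4(1) by blast
  obtain C\<^sub>1 where C\<^sub>1: "log_weights d \<rho> C\<^sub>1"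
    using log_weightsI[OF d_pos C3(1) weight_sum_at_top[OF d_pos C2(1)] C3(2)] by blast
  interpret log_weights d \<rho> C\<^sub>1 by (rule C\<^sub>1)
  interpret indep_finite_moments M X m
    by unfold_locales (use indep fmX m in auto)
  have walk: "walk n \<omega> = partial_sum X n \<omega>" for n \<omega> by (simp add: walk_def partial_sum_def)
  interpret normalized_walk M X m a b C\<^sub>0
    by unfold_locales (use a_pos C\<^sub>0 in \<open>auto simp: walk normalized_sum_def\<close>)
  interpret weighted_walk M X m a b C\<^sub>0 d \<rho> C\<^sub>1 C\<^sub>a \<beta>
    by unfold_locales (use C\<^sub>a m_large in auto)
  have Y: "Y n = ?Y n" for n by (simp add: Y_def[abs_def] walk normalized_sum_def[abs_def])
  let ?P = "interval_measure H"
  have H: "\<And>x y. x \<le> y \<Longrightarrow> H x \<le> H y" "\<And>x. continuous (at_right x) H" "(H \<longlongrightarrow> 0) at_bot" "(H \<longlongrightarrow> 1) at_top"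
    using C1(1) by (auto simp: distribution_function_def mono_def)
  have P: "real_distribution ?P" by (rule real_distribution_interval_measure[OF H])
  have cdf_H: "cdf ?P = H" by (rule cdf_interval_measure[where F = H]) (use H in auto)
  have conv: "weak_conv_m (\<lambda>n. distr M borel (Y n)) ?P"
    using C1(2) by (simp add: weak_conv_m_def Y cdf_H)
  have lipschitz_mean: "integrable ?P g \<and> (\<lambda>n. expectation (\<lambda>\<omega>. g (Y n \<omega>))) \<longlonglongrightarrow> (\<integral>x. g x \<partial>?P)"
    if g: "L-lipschitz_on UNIV g" for g :: "real \<Rightarrow> real" and L
  proof -
    have cont: "isCont g x" for x
      using lipschitz_on_continuous_on[OF g] by (simp add: continuous_on_eq_continuous_at)
    have [measurable]: "g \<in> borel_measurable borel"
      by (intro borel_measurable_continuous_onI lipschitz_on_continuous_on[OF g])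
    have [measurable]: "Y n \<in> borel_measurable M" for n by (simp add: Y)
    have L: "L \<ge> 0" by (rule lipschitz_on_nonneg[OF g])
    have fmg: "finite_moment 2 (\<lambda>\<omega>. g (Y n \<omega>))" for n
      by (rule finite_moment_mono[OF finite_moment_lipschitz[OF finite_moment_Y g]]) (use m in simp)
    define B where "B = 2 * ((g 0)\<^sup>2 + L\<^sup>2 * (1 + C\<^sub>0))"
    have B: "expectation (\<lambda>\<omega>. (g (Y n \<omega>))\<^sup>2) \<le> B" if n: "1 \<le> n" for n
    proof -
      have intm: "integrable M (\<lambda>\<omega>. Y n \<omega> ^ (2 * m))" by (rule finite_moment_integrable_power[OF finite_moment_Y]) simp
      have "expectation (\<lambda>\<omega>. (g (Y n \<omega>))\<^sup>2) \<le> expectation (\<lambda>\<omega>. 2 * ((g 0)\<^sup>2 + L\<^sup>2 * (1 + Y n \<omega> ^ (2 * m))))"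
      proof (rule integral_mono)
        show "integrable M (\<lambda>\<omega>. (g (Y n \<omega>))\<^sup>2)" by (rule finite_moment_integrable_power[OF fmg]) simp
        show "integrable M (\<lambda>\<omega>. 2 * ((g 0)\<^sup>2 + L\<^sup>2 * (1 + Y n \<omega> ^ (2 * m))))" using intm by simp
        fix \<omega>
        define y where "y = Y n \<omega>"
        have "\<bar>g y\<bar> \<le> \<bar>g 0\<bar> + L * \<bar>y\<bar>"
          using lipschitz_onD[OF g, of y 0] by (simp add: dist_real_def)
        hence "\<bar>g y\<bar>\<^sup>2 \<le> (\<bar>g 0\<bar> + L * \<bar>y\<bar>)\<^sup>2" by (intro power_mono) auto
        also have "\<dots> \<le> 2 * ((g 0)\<^sup>2 + L\<^sup>2 * y\<^sup>2)"
          using sum_squares_bound[of "\<bar>g 0\<bar>" "L * \<bar>y\<bar>"] by (simp add: power2_sum power_mult_distrib)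
        also have "y\<^sup>2 \<le> 1 + y ^ (2 * m)"
          using power_le_one_plus_power[of "\<bar>y\<bar>" 2 "2 * m"] m(1) by (simp add: power_even_abs)
        finally show "(g (Y n \<omega>))\<^sup>2 \<le> 2 * ((g 0)\<^sup>2 + L\<^sup>2 * (1 + Y n \<omega> ^ (2 * m)))"
          by (simp add: y_def mult_left_mono)
      qed
      also have "\<dots> = 2 * ((g 0)\<^sup>2 + L\<^sup>2 * (1 + expectation (\<lambda>\<omega>. Y n \<omega> ^ (2 * m))))"
        using intm by (simp add: prob_space)
      also have "\<dots> \<le> B"
        unfolding B_def using C\<^sub>0[OF n] by (intro mult_left_mono add_left_mono) (auto simp: Y)
      finally show ?thesis .
    qed
    have rd: "real_distribution (distr M borel (Y n))" for n
      by (rule real_distribution_distr) simp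
    have int2: "integrable (distr M borel (Y n)) (\<lambda>x. (g x)\<^sup>2)" for n
      using finite_moment_integrable_power[OF fmg, of 2 n] by (subst integrable_distr_eq) auto
    have B': "(\<integral>x. (g x)\<^sup>2 \<partial>distr M borel (Y n)) \<le> B" if "1 \<le> n" for n
      using B[OF that] by (subst integral_distr) auto
    have "(\<integral>x. g x \<partial>distr M borel (Y n)) = expectation (\<lambda>\<omega>. g (Y n \<omega>))" for n
      by (subst integral_distr) auto
    with weak_conv_bounded_second_moment[OF rd P conv cont int2 B'] show ?thesis by simp
  qed
  show ?thesis
  proof (intro allI impI, elim exE)
    fix f :: "real \<Rightarrow> real" and L assume f: "L-lipschitz_on UNIV f"
    have "AE \<omega> in M. (\<lambda>N. weighted_total f N \<omega> / weight_sum d N) \<longlonglongrightarrow> (\<integral>x. f x \<partial>?P)"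
      using lipschitz_mean by (intro AE_tendsto[OF f]) (use f in auto)
    with lipschitz_mean[OF f] show "integrable ?P f \<and>
           (AE \<omega> in M. (\<lambda>N. (\<Sum>k=1..N. d k * f (?Y k \<omega>)) / weight_sum d N) \<longlonglongrightarrow> (\<integral>x. f x \<partial>?P))"
      by (simp add: weighted_total_def Y)
  qed
qed

end
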